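(* Any randomized (Monte Carlo) SLOCAL algorithm with locality $r(n)$ for a locally checkable distributed graph problem can be transformed into a deterministic SLOCAL algorithm for the same problem with locality $O(r(n)\log^2 n)$.
   Context: A distributed graph problem is posed on an $n$-node graph $G$ whose nodes have unique $O(\log n)$-bit identifiers (and possibly inputs); each node outputs a value, and the problem specifies which outputs are valid. It is locally checkable if validity of a solution can be decided by each node inspecting its constant-radius neighborhood (all nodes accept iff the solution is valid). In the SLOCAL model with locality $r$, nodes are processed sequentially in an arbitrary (adversarially chosen) order; when processed, a node reads its $r$-hop neighborhood including information stored by previously processed nodes, and computes and stores its output. A randomized Monte Carlo SLOCAL algorithm gives nodes private random bits and must produce a valid solution with probability strictly larger than $1-1/n$.
   Formalization: The locality is assumed to satisfy r(n) ≥ 1 for all n; with r(n) = 0 the bound O(r(n) log² n) would be 0 and the claim fails (e.g. for splitting by random colouring). *)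

theory Defs
  imports "HOL-Probability.Probability" "HOL-Library.Landau_Symbols"
begin

text \<open>
  Node names are the unique identifiers, hence natural numbers. A graph carries a label at each of
  its nodes (an input, or an input together with what is currently written at the node).
\<close>

record 'a lgraph =
  nodes :: "nat set"
  edges :: "nat rel"
  label :: "nat \<rightharpoonup> 'a"

abbreviation size_of :: "'a lgraph \<Rightarrow> nat" where
  "size_of G \<equiv> card (nodes G)"

text \<open>
  Simple undirected graphs on \<open>n \<ge> 1\<close> nodes; \<open>b n\<close> is the length in bits of the identifiers.
\<close>

definition network :: "(nat \<Rightarrow> nat) \<Rightarrow> 'i lgraph \<Rightarrow> bool" where
  "network b G \<longleftrightarrow>
     finite (nodes G) \<and> nodes G \<noteq> {} \<and> nodes G \<subseteq> {..<2 ^ b (size_of G)} \<and>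
     edges G \<subseteq> nodes G \<times> nodes G \<and> sym (edges G) \<and> irrefl (edges G) \<and>
     dom (label G) = nodes G"

definition hop_ball :: "'a lgraph \<Rightarrow> nat \<Rightarrow> nat \<Rightarrow> nat set" where
  "hop_ball G r v = {u. \<exists>k\<le>r. (v, u) \<in> edges G ^^ k}"

definition view :: "'a lgraph \<Rightarrow> nat \<Rightarrow> nat \<Rightarrow> 'a lgraph" where
  "view G r v =
     \<lparr>nodes = hop_ball G r v,
      edges = edges G \<inter> hop_ball G r v \<times> hop_ball G r v,
      label = label G |` hop_ball G r v\<rparr>"

definition annotate :: "'a lgraph \<Rightarrow> (nat \<Rightarrow> 'c) \<Rightarrow> ('a \<times> 'c) lgraph" where
  "annotate G f =
     \<lparr>nodes = nodes G, edges = edges G, label = (\<lambda>v. map_option (\<lambda>i. (i, f v)) (label G v))\<rparr>"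

text \<open>
  A problem may come with a promise: \<open>instances\<close> are the input-labelled graphs on which it is posed.
\<close>

record ('i, 'o) problem =
  instances :: "'i lgraph set"
  valid :: "'i lgraph \<Rightarrow> (nat \<rightharpoonup> 'o) \<Rightarrow> bool"

text \<open>
  The local verifier knows \<open>n\<close> and the identifier of the node at which it runs; its radius \<open>d\<close> is
  an absolute constant.
\<close>

definition locally_checkable :: "(nat \<Rightarrow> nat) \<Rightarrow> ('i, 'o) problem \<Rightarrow> bool" where
  "locally_checkable b P \<longleftrightarrow>
     (\<exists>(d :: nat) (accept :: nat \<Rightarrow> nat \<Rightarrow> ('i \<times> 'o option) lgraph \<Rightarrow> bool).
        \<forall>G \<in> instances P. network b G \<longrightarrow>
          (\<forall>out. dom out = nodes G \<longrightarrow>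
             (valid P G out \<longleftrightarrow>
              (\<forall>v \<in> nodes G. accept (size_of G) v (view (annotate G out) d v)))))"

text \<open>
  A processed node stores its output and an arbitrary finite bit string; a node that has not been
  processed yet stores nothing.
\<close>

type_synonym 'o stored = "'o \<times> bool list"

text \<open>Arguments of an algorithm: \<open>n\<close>, the identifier of the node being processed, its view.\<close>

type_synonym ('i, 'o) slocal_alg =
  "nat \<Rightarrow> nat \<Rightarrow> ('i \<times> 'o stored option) lgraph \<Rightarrow> 'o stored"

type_synonym ('i, 'o) rand_slocal_alg =
  "nat \<Rightarrow> nat \<Rightarrow> (nat \<Rightarrow> bool) \<Rightarrow> ('i \<times> 'o stored option) lgraph \<Rightarrow> 'o stored"

definition slocal_run ::
  "(nat \<Rightarrow> ('i \<times> 'o stored option) lgraph \<Rightarrow> 'o stored) \<Rightarrow> nat \<Rightarrow> 'i lgraph \<Rightarrow> nat list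
     \<Rightarrow> (nat \<rightharpoonup> 'o stored)" where
  "slocal_run step r G ord =
     fold (\<lambda>v S. S(v \<mapsto> step v (view (annotate G S) r v))) ord Map.empty"

definition slocal_output ::
  "(nat \<Rightarrow> ('i \<times> 'o stored option) lgraph \<Rightarrow> 'o stored) \<Rightarrow> nat \<Rightarrow> 'i lgraph \<Rightarrow> nat list
     \<Rightarrow> (nat \<rightharpoonup> 'o)" where
  "slocal_output step r G ord = map_option fst \<circ> slocal_run step r G ord"

definition processing_order :: "'i lgraph \<Rightarrow> nat list \<Rightarrow> bool" where
  "processing_order G ord \<longleftrightarrow> distinct ord \<and> set ord = nodes G"

definition slocal_solves ::
  "(nat \<Rightarrow> nat) \<Rightarrow> ('i, 'o) problem \<Rightarrow> ('i, 'o) slocal_alg \<Rightarrow> (nat \<Rightarrow> nat) \<Rightarrow> bool" where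
  "slocal_solves b P A r \<longleftrightarrow>
     (\<forall>G \<in> instances P. network b G \<longrightarrow>
        (\<forall>ord. processing_order G ord \<longrightarrow>
           valid P G (slocal_output (A (size_of G)) (r (size_of G)) G ord)))"

text \<open>The private randomness of one node: an unbounded supply of independent fair bits.\<close>

definition fair_bits :: "(nat \<Rightarrow> bool) measure" where
  "fair_bits = PiM UNIV (\<lambda>_. measure_pmf (bernoulli_pmf (1/2)))"

definition node_bits :: "'i lgraph \<Rightarrow> (nat \<Rightarrow> nat \<Rightarrow> bool) measure" where
  "node_bits G = PiM (nodes G) (\<lambda>_. fair_bits)"

text \<open>
  The order is fixed before the random bits are drawn. Since stored values range over a countable
  type, measurability of the single steps makes the success event measurable.
\<close>

definition monte_carlo_slocal_solves ::
  "(nat \<Rightarrow> nat) \<Rightarrow> ('i, 'o::countable) problem \<Rightarrow> ('i, 'o) rand_slocal_alg \<Rightarrow> (nat \<Rightarrow> nat)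
     \<Rightarrow> bool" where
  "monte_carlo_slocal_solves b P A r \<longleftrightarrow>
     (\<forall>n v W. (\<lambda>x. A n v x W) \<in> fair_bits \<rightarrow>\<^sub>M count_space UNIV) \<and>
     (\<forall>G \<in> instances P. network b G \<longrightarrow>
        (\<forall>ord. processing_order G ord \<longrightarrow>
           measure (node_bits G)
             {x \<in> space (node_bits G).
                valid P G (slocal_output (\<lambda>v. A (size_of G) v (x v)) (r (size_of G)) G ord)}
           > 1 - 1 / real (size_of G)))"

end

theory Submission
  imports Defs
begin

text \<open>
  Idea. Carving balls by region growing, with radii that are multiples of \<open>r\<close>, assigns to each node a
  level below \<open>L = O(log n)\<close> such that nodes of equal level at distance at most \<open>r\<close> belong to a common
  cluster of radius \<open>O(r log n)\<close>: the ball stops growing when the next shell is at most as large as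
  the ball, the shell is passed on to the next level, and so every level loses at least half of its
  nodes. If the randomized algorithm is run in the order of (level, identifier), every chain of
  dependencies stays within distance \<open>T = O(r log\<^sup>2 n)\<close>. Each node rejects with probability less than
  \<open>1/n\<close>, so the expected number of rejecting nodes is below 1, and the method of conditional
  expectations fixes the stored values one by one. Fixing a value changes only the failure
  probabilities within distance \<open>T\<close>, so the choice is local; it is made for the stored values instead of
  the random bits because a node cannot store an infinite bit sequence.

  The adversary's order is dealt with by letting each processed node carve and fix everything that it
  needs in its neighbourhood. It stores a time-stamped copy of the states around it, which turns
  updates of remote nodes into updates of a node's own memory.
\<close>

section \<open>Graphs, views and runs\<close>

lemma hop_ballI: "(v, u) \<in> edges G ^^ k \<Longrightarrow> k \<le> r \<Longrightarrow> u \<in> hop_ball G r v"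
  unfolding hop_ball_def by blast

lemma hop_ball_self [simp]: "v \<in> hop_ball G r v"
  by (rule hop_ballI[where k = 0]) auto

lemma hop_ball_0 [simp]: "hop_ball G 0 v = {v}"
  by (auto simp: hop_ball_def)

lemma hop_ball_mono: "u \<in> hop_ball G r v \<Longrightarrow> r \<le> r' \<Longrightarrow> u \<in> hop_ball G r' v"
  unfolding hop_ball_def by (blast intro: order_trans)

lemma hop_ball_trans:
  assumes "u \<in> hop_ball G a v" "w \<in> hop_ball G c u" "a + c \<le> R"
  shows "w \<in> hop_ball G R v"
proof -
  obtain i j where "i \<le> a" "(v, u) \<in> edges G ^^ i" "j \<le> c" "(u, w) \<in> edges G ^^ j"
    using assms unfolding hop_ball_def by blast
  then have "(v, w) \<in> edges G ^^ (i + j)" and "i + j \<le> R"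
    using assms(3) by (auto simp: relpow_add)
  then show ?thesis by (rule hop_ballI)
qed

lemma hop_ball_sym:
  assumes "sym (edges G)" "u \<in> hop_ball G r v" shows "v \<in> hop_ball G r u"
proof -
  have "sym (edges G ^^ k)" for k
  proof (induction k)
    case (Suc k)
    have "(edges G ^^ Suc k)\<inverse> = edges G ^^ Suc k"
      using Suc assms(1) by (simp add: converse_relcomp sym_conv_converse_eq relpow_commute)
    then show ?case by (simp add: sym_conv_converse_eq)
  qed (simp add: sym_Id)
  then show ?thesis using assms(2) unfolding hop_ball_def sym_def by blast
qed

lemma hop_ball_subset:
  assumes "edges G \<subseteq> nodes G \<times> nodes G" "v \<in> nodes G"
  shows "hop_ball G r v \<subseteq> nodes G"
proof
  fix u assume "u \<in> hop_ball G r v"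
  then obtain k where k: "(v, u) \<in> edges G ^^ k" unfolding hop_ball_def by blast
  show "u \<in> nodes G"
  proof (cases k)
    case (Suc j)
    then obtain w where "(w, u) \<in> edges G" using k by auto
    then show ?thesis using assms by blast
  qed (use k assms in auto)
qed

lemma hop_ball_cong: "edges G = edges G' \<Longrightarrow> hop_ball G = hop_ball G'"
  by (simp add: hop_ball_def fun_eq_iff)

lemma nodes_view [simp]: "nodes (view G r v) = hop_ball G r v"
  and edges_view [simp]: "edges (view G r v) = edges G \<inter> hop_ball G r v \<times> hop_ball G r v"
  and label_view [simp]: "label (view G r v) = label G |` hop_ball G r v"
  by (simp_all add: view_def)

lemma nodes_annotate [simp]: "nodes (annotate G f) = nodes G"
  and edges_annotate [simp]: "edges (annotate G f) = edges G"
  and label_annotate [simp]: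
    "label (annotate G f) = (\<lambda>v. map_option (\<lambda>i. (i, f v)) (label G v))"
  by (simp_all add: annotate_def)

lemma hop_ball_annotate [simp]: "hop_ball (annotate G f) = hop_ball G"
  by (rule hop_ball_cong) simp

lemma view_annotate: "view (annotate G f) r v = annotate (view G r v) f"
  by (rule lgraph.equality) (auto simp: restrict_map_def)

lemma annotate_view_cong:
  "(\<And>u. u \<in> hop_ball G r v \<Longrightarrow> f u = g u) \<Longrightarrow>
   annotate (view G r v) f = annotate (view G r v) g"
  by (rule lgraph.equality) (auto simp: restrict_map_def fun_eq_iff map_option_case split: option.split)

text \<open>A path of length at most \<open>r\<close> from \<open>w\<close> stays within
  \<open>a + r\<close> of \<open>v\<close>, so restricting the edges to the view cuts none of these
  paths.\<close>

lemma hop_ball_view: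
  assumes w: "w \<in> hop_ball G a v" and le: "a + r \<le> R"
  shows "hop_ball (view G R v) r w = hop_ball G r w"
proof -
  have "(w, u) \<in> edges (view G R v) ^^ k" if "(w, u) \<in> edges G ^^ k" "k \<le> r" for k u
    using that
  proof (induction k arbitrary: u)
    case (Suc k)
    then obtain x where x: "(w, x) \<in> edges G ^^ k" "(x, u) \<in> edges G" by auto
    have "x \<in> hop_ball G k w" "u \<in> hop_ball G (Suc k) w"
      using x(1) Suc.prems(1) by (auto intro: hop_ballI simp del: relpow.simps)
    then have "x \<in> hop_ball G R v" "u \<in> hop_ball G R v"
      using hop_ball_trans[OF w] le Suc.prems(2) by (metis Suc_leD add_left_mono order_trans)+
    then have "(x, u) \<in> edges (view G R v)" using x(2) by simp
    with Suc.IH[OF x(1)] Suc.prems(2) show ?case by auto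
  qed auto
  moreover have "(w, u) \<in> edges G ^^ k" if "(w, u) \<in> edges (view G R v) ^^ k" for k u
    using that by (induction k arbitrary: u) auto
  ultimately show ?thesis unfolding hop_ball_def by blast
qed

text \<open>Hence a node that has the view of radius \<open>R\<close> can evaluate smaller views
  around nodes near it, which is how it simulates their steps.\<close>

lemma view_view:
  assumes w: "w \<in> hop_ball G a v" and le: "a + r \<le> R"
  shows "view (view G R v) r w = view G r w"
proof -
  have "hop_ball G r w \<subseteq> hop_ball G R v"
    using hop_ball_trans[OF w _ le] by blast
  then show ?thesis
    by (intro lgraph.equality) (auto simp: hop_ball_view[OF assms] restrict_map_def fun_eq_iff)
qed

definition well_formed :: "'a lgraph \<Rightarrow> bool" where
  "well_formed G \<longleftrightarrow> finite (nodes G) \<and> edges G \<subseteq> nodes G \<times> nodes G \<and> sym (edges G)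
     \<and> dom (label G) = nodes G"

lemma network_well_formed: "network b G \<Longrightarrow> well_formed G"
  by (simp add: network_def well_formed_def)

lemma finite_hop_ball: "well_formed G \<Longrightarrow> v \<in> nodes G \<Longrightarrow> finite (hop_ball G r v)"
  unfolding well_formed_def using hop_ball_subset finite_subset by metis

section \<open>The order by level and identifier\<close>

definition prec :: "(nat \<Rightarrow> nat) \<Rightarrow> nat \<Rightarrow> nat \<Rightarrow> bool" where
  "prec lev u v \<longleftrightarrow> lev u < lev v \<or> lev u = lev v \<and> u < v"

lemma prec_irrefl [simp]: "\<not> prec lev u u"
  by (simp add: prec_def)

lemma prec_trans: "prec lev u v \<Longrightarrow> prec lev v w \<Longrightarrow> prec lev u w"
  by (auto simp: prec_def)

lemma wf_prec: "wf {(u, v). prec lev u v}"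
proof -
  have "{(u, v). prec lev u v} = inv_image (less_than <*lex*> less_than) (\<lambda>u. (lev u, u))"
    by (auto simp: prec_def)
  then show ?thesis by (simp add: wf_inv_image wf_lex_prod)
qed

text \<open>\<open>sort_key\<close> is stable, so nodes of equal level keep the increasing order of
  identifiers and the list is sorted by \<open>prec lev\<close>.\<close>

definition level_order :: "(nat \<Rightarrow> nat) \<Rightarrow> nat set \<Rightarrow> nat list" where
  "level_order lev V = sort_key lev (sorted_list_of_set V)"

lemma sorted_wrt_insort_key_prec:
  "sorted_wrt (prec lev) xs \<Longrightarrow> (\<And>y. y \<in> set xs \<Longrightarrow> x < y) \<Longrightarrow>
   sorted_wrt (prec lev) (insort_key lev x xs)"
proof (induction xs)
  case (Cons y ys)
  then show ?case
    by (auto simp: set_insort_key prec_def)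
qed simp

lemma sorted_wrt_sort_key_prec:
  "sorted_wrt (<) xs \<Longrightarrow> sorted_wrt (prec lev) (sort_key lev xs)"
  by (induction xs) (auto intro: sorted_wrt_insort_key_prec)

lemma sorted_wrt_level_order: "sorted_wrt (prec lev) (level_order lev V)"
  unfolding level_order_def by (intro sorted_wrt_sort_key_prec strict_sorted_list_of_set)

lemma distinct_level_order [simp]: "distinct (level_order lev V)"
  by (simp add: level_order_def)

lemma set_level_order [simp]: "finite V \<Longrightarrow> set (level_order lev V) = V"
  by (simp add: level_order_def)

lemma processing_order_level_order:
  "finite (nodes G) \<Longrightarrow> processing_order G (level_order lev (nodes G))"
  by (simp add: processing_order_def)

section \<open>Runs and their description by fixpoint equations\<close>

lemma slocal_run_Nil [simp]: "slocal_run step r G [] = Map.empty"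
  by (simp add: slocal_run_def)

lemma slocal_run_snoc:
  "slocal_run step r G (xs @ [v]) =
     (slocal_run step r G xs)(v \<mapsto> step v (view (annotate G (slocal_run step r G xs)) r v))"
  by (simp add: slocal_run_def)

lemma dom_slocal_run [simp]: "dom (slocal_run step r G xs) = set xs"
  by (induction xs rule: rev_induct) (simp_all add: slocal_run_snoc del: fun_upd_apply)

lemma slocal_run_prefix:
  "distinct (xs @ ys) \<Longrightarrow> u \<in> set xs \<Longrightarrow> slocal_run step r G (xs @ ys) u = slocal_run step r G xs u"
proof (induction ys rule: rev_induct)
  case (snoc y ys)
  then show ?case by (auto simp: slocal_run_snoc simp flip: append_assoc)
qed simp

text \<open>A description of runs without lists: a value is computed from the values of the
  \<open>prec\<close>-predecessors alone. Runs on different graphs and with different levels become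
  comparable this way.\<close>

definition slocal_fixpoint where
  "slocal_fixpoint step r G lev V S \<longleftrightarrow> dom S = V \<and>
     (\<forall>v\<in>V. S v = Some (step v (annotate (view G r v) (S |` {u. prec lev u v}))))"

lemma slocal_fixpoint_run:
  assumes "distinct xs" "sorted_wrt (prec lev) xs"
  shows "slocal_fixpoint step r G lev (set xs) (slocal_run step r G xs)"
  using assms
proof (induction xs rule: rev_induct)
  case (snoc x xs)
  let ?S = "slocal_run step r G"
  from snoc have IH: "slocal_fixpoint step r G lev (set xs) (?S xs)"
    and less: "\<And>y. y \<in> set xs \<Longrightarrow> prec lev y x" and x: "x \<notin> set xs"
    by (auto simp: sorted_wrt_append)
  \<comment> \<open>The appended node is no predecessor of any node in the enlarged set, so the
    equations of the earlier nodes persist.\<close>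
  have not_x: "\<not> prec lev x v" if "v \<in> insert x (set xs)" for v
    using that less prec_trans prec_irrefl by blast
  have "?S (xs @ [x]) |` {u. prec lev u v} = ?S xs |` {u. prec lev u v}"
    if "v \<in> insert x (set xs)" for v
    using not_x[OF that] by (auto simp: slocal_run_snoc restrict_map_def)
  moreover have "?S xs |` {u. prec lev u x} = ?S xs"
  proof (rule ext)
    show "(?S xs |` {u. prec lev u x}) u = ?S xs u" for u
      using less[of u] domIff[of u "?S xs"] by (cases "?S xs u") (auto simp: restrict_map_def)
  qed
  ultimately show ?case
    using IH x unfolding slocal_fixpoint_def
    by (auto simp: slocal_run_snoc view_annotate)
qed (simp add: slocal_fixpoint_def)

lemma slocal_fixpoint_unique:
  assumes "slocal_fixpoint step r G lev V S" "slocal_fixpoint step r G lev V S'"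
  shows "S = S'"
proof
  fix v show "S v = S' v"
  proof (induction v rule: wf_induct_rule[OF wf_prec[of lev]])
    case (1 v)
    then have "S |` {u. prec lev u v} = S' |` {u. prec lev u v}"
      by (auto simp: restrict_map_def)
    then show ?case
      using assms unfolding slocal_fixpoint_def by (cases "v \<in> V") (auto simp: domIff)
  qed
qed

text \<open>Well-founded induction along \<open>prec\<close>: a value depends only on predecessors
  within distance \<open>r\<close>, and \<open>closed\<close> keeps these inside \<open>X\<close>.
  Outside \<open>X\<close> the two systems may differ; this later lets a run on a view replace a run
  on the whole graph.\<close>

lemma slocal_fixpoint_local:
  assumes S: "slocal_fixpoint step r G lev V S" and S': "slocal_fixpoint step' r G' lev' V' S'"
    and X: "X \<subseteq> V" "X \<subseteq> V'"
    and step: "\<And>v. v \<in> X \<Longrightarrow> step v = step' v"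
    and view: "\<And>v. v \<in> X \<Longrightarrow> view G r v = view G' r v"
    and prec: "\<And>u v. v \<in> X \<Longrightarrow> u \<in> hop_ball G r v \<Longrightarrow> prec lev u v \<longleftrightarrow> prec lev' u v"
    and closed: "\<And>u v. v \<in> X \<Longrightarrow> u \<in> hop_ball G r v \<Longrightarrow> prec lev u v \<Longrightarrow> u \<in> X"
    and "v \<in> X"
  shows "S v = S' v"
  using \<open>v \<in> X\<close>
proof (induction v rule: wf_induct_rule[OF wf_prec[of lev]])
  case (1 v)
  have "annotate (view G r v) (S |` {u. prec lev u v}) =
        annotate (view G r v) (S' |` {u. prec lev' u v})"
  proof (rule annotate_view_cong)
    fix u assume u: "u \<in> hop_ball G r v"
    show "(S |` {u. prec lev u v}) u = (S' |` {u. prec lev' u v}) u"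
      using 1(1)[of u] closed[OF 1(2) u] prec[OF 1(2) u] by (simp add: restrict_map_def)
  qed
  then show ?case
    using S S' X 1(2) step[OF 1(2)] view[OF 1(2)] unfolding slocal_fixpoint_def
    by (metis subsetD)
qed

section \<open>Local updates of a global state\<close>

text \<open>The operations of a stronger model, in which node \<open>v\<close> may also overwrite
  the states of other nodes within distance \<open>\<rho>\<close>. The simulation by
  \<open>remote_step\<close> brings them back to SLOCAL steps.\<close>

definition local_update :: "nat \<Rightarrow> ('i lgraph \<Rightarrow> nat \<Rightarrow> (nat \<Rightarrow> 's) \<Rightarrow> nat \<Rightarrow> 's) \<Rightarrow> bool" where
  "local_update \<rho> \<phi> \<longleftrightarrow>
     (\<forall>G v \<sigma> u. u \<notin> hop_ball G \<rho> v \<longrightarrow> \<phi> G v \<sigma> u = \<sigma> u) \<and>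
     (\<forall>G G' v \<sigma> \<sigma>' u. view G \<rho> v = view G' \<rho> v \<longrightarrow> (\<forall>w\<in>hop_ball G \<rho> v. \<sigma> w = \<sigma>' w) \<longrightarrow>
        u \<in> hop_ball G \<rho> v \<longrightarrow> \<phi> G v \<sigma> u = \<phi> G' v \<sigma>' u)"

lemma local_update_outside:
  "local_update \<rho> \<phi> \<Longrightarrow> u \<notin> hop_ball G \<rho> v \<Longrightarrow> \<phi> G v \<sigma> u = \<sigma> u"
  by (simp add: local_update_def)

lemma local_update_inside:
  "local_update \<rho> \<phi> \<Longrightarrow> view G \<rho> v = view G' \<rho> v \<Longrightarrow>
   (\<And>w. w \<in> hop_ball G \<rho> v \<Longrightarrow> \<sigma> w = \<sigma>' w) \<Longrightarrow> u \<in> hop_ball G \<rho> v \<Longrightarrow>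
   \<phi> G v \<sigma> u = \<phi> G' v \<sigma>' u"
  by (simp add: local_update_def)

text \<open>Makes an arbitrary update local by construction: it runs on the view, sees
  \<open>undefined\<close> outside the ball, and its writes outside are discarded.\<close>

definition localize ::
  "nat \<Rightarrow> ('i lgraph \<Rightarrow> nat \<Rightarrow> (nat \<Rightarrow> 's) \<Rightarrow> nat \<Rightarrow> 's) \<Rightarrow> 'i lgraph \<Rightarrow> nat \<Rightarrow> (nat \<Rightarrow> 's) \<Rightarrow> nat \<Rightarrow> 's"
  where
  "localize \<rho> \<phi> G v \<sigma> = (\<lambda>u. if u \<in> hop_ball G \<rho> v
     then \<phi> (view G \<rho> v) v (\<lambda>w. if w \<in> hop_ball G \<rho> v then \<sigma> w else undefined) u else \<sigma> u)"

lemma view_eq_hop_ball: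
  "view G R v = view G' R v \<Longrightarrow> hop_ball G R v = hop_ball G' R v"
  by (metis nodes_view)

lemma local_update_localize:
  fixes \<phi> :: "'i lgraph \<Rightarrow> nat \<Rightarrow> (nat \<Rightarrow> 's) \<Rightarrow> nat \<Rightarrow> 's"
  shows "local_update \<rho> (localize \<rho> \<phi>)"
  unfolding local_update_def
proof (intro conjI allI impI)
  fix G G' :: "'i lgraph" and v u and \<sigma> \<sigma>' :: "nat \<Rightarrow> 's"
  assume eq: "view G \<rho> v = view G' \<rho> v" and \<sigma>: "\<forall>w\<in>hop_ball G \<rho> v. \<sigma> w = \<sigma>' w"
    and u: "u \<in> hop_ball G \<rho> v"
  have ball: "hop_ball G' \<rho> v = hop_ball G \<rho> v" using view_eq_hop_ball[OF eq] by simp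
  have "(\<lambda>w. if w \<in> hop_ball G \<rho> v then \<sigma> w else undefined) =
        (\<lambda>w. if w \<in> hop_ball G \<rho> v then \<sigma>' w else undefined)"
    using \<sigma> by auto
  then show "localize \<rho> \<phi> G v \<sigma> u = localize \<rho> \<phi> G' v \<sigma>' u"
    using u unfolding localize_def ball eq by simp
qed (simp add: localize_def)

text \<open>Each update is centred within \<open>Q\<close> of \<open>v\<close> and reaches
  \<open>\<rho>\<close> further. The list is a function of the ball, so that graphs with the same
  view around \<open>v\<close> process the same nodes.\<close>

lemma local_update_fold:
  fixes \<phi> :: "'i lgraph \<Rightarrow> nat \<Rightarrow> (nat \<Rightarrow> 's) \<Rightarrow> nat \<Rightarrow> 's"
  assumes \<phi>: "local_update \<rho> \<phi>"
    and xs: "\<And>(G :: 'i lgraph) v. set (xs (hop_ball G Q v)) \<subseteq> hop_ball G Q v"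
  shows "local_update (Q + \<rho>) (\<lambda>G v. fold (\<phi> G) (xs (hop_ball G Q v)))"
proof -
  have outside: "fold (\<phi> G) ws \<sigma> u = \<sigma> u"
    if "set ws \<subseteq> hop_ball G Q v" "u \<notin> hop_ball G (Q + \<rho>) v" for G v \<sigma> u ws
    using that(1)
  proof (induction ws arbitrary: \<sigma>)
    case (Cons w ws)
    then have "u \<notin> hop_ball G \<rho> w" using that(2) hop_ball_trans[of w G Q v u \<rho>] by auto
    then show ?case using Cons local_update_outside[OF \<phi>] by simp
  qed simp
  have inside: "fold (\<phi> G) ws \<sigma> u = fold (\<phi> G') ws \<sigma>' u"
    if eq: "view G (Q + \<rho>) v = view G' (Q + \<rho>) v" and u: "u \<in> hop_ball G (Q + \<rho>) v"
      and "\<forall>w\<in>hop_ball G (Q + \<rho>) v. \<sigma> w = \<sigma>' w" "set ws \<subseteq> hop_ball G Q v" for G G' v \<sigma> \<sigma>' u ws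
    using that(3-)
  proof (induction ws arbitrary: \<sigma> \<sigma>')
    case (Cons w ws)
    then have w: "w \<in> hop_ball G Q v" by simp
    \<comment> \<open>Both balls of radius \<open>Q\<close> can be read off from the common view of
      radius \<open>Q + \<rho>\<close>.\<close>
    have "hop_ball G' Q v = hop_ball G Q v"
      using hop_ball_view[of v G 0 v Q "Q + \<rho>"] hop_ball_view[of v G' 0 v Q "Q + \<rho>"] eq by simp
    then have "w \<in> hop_ball G' Q v" using w by simp
    then have view: "view G \<rho> w = view G' \<rho> w"
      using view_view[OF w order_refl, of \<rho>] view_view[of w G' Q v \<rho> "Q + \<rho>"] eq by simp
    have sub: "hop_ball G \<rho> w \<subseteq> hop_ball G (Q + \<rho>) v"
      using hop_ball_trans[OF w] by blast
    have "\<phi> G w \<sigma> x = \<phi> G' w \<sigma>' x" if "x \<in> hop_ball G (Q + \<rho>) v" for x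
    proof (cases "x \<in> hop_ball G \<rho> w")
      case True
      then show ?thesis using sub Cons.prems by (intro local_update_inside[OF \<phi> view]) auto
    next
      case False
      then show ?thesis
        using that Cons.prems local_update_outside[OF \<phi>] view_eq_hop_ball[OF view] by metis
    qed
    then show ?case using Cons by simp
  qed (use u in simp)
  show ?thesis
    unfolding local_update_def
  proof (intro conjI allI impI)
    fix G G' :: "'i lgraph" and v u and \<sigma> \<sigma>' :: "nat \<Rightarrow> 's"
    assume eq: "view G (Q + \<rho>) v = view G' (Q + \<rho>) v"
      and *: "\<forall>w\<in>hop_ball G (Q + \<rho>) v. \<sigma> w = \<sigma>' w" "u \<in> hop_ball G (Q + \<rho>) v"
    have "hop_ball G' Q v = hop_ball G Q v"
      using hop_ball_view[of v G 0 v Q "Q + \<rho>"] hop_ball_view[of v G' 0 v Q "Q + \<rho>"] eq by simp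
    then show "fold (\<phi> G) (xs (hop_ball G Q v)) \<sigma> u = fold (\<phi> G') (xs (hop_ball G' Q v)) \<sigma>' u"
      using inside[OF eq *(2,1) xs] by simp
  qed (use outside[OF xs] in simp)
qed

section \<open>Simulating remote writes by snapshots\<close>

definition encode :: "'c::countable \<Rightarrow> bool list" where
  "encode c = replicate (to_nat c) True"

text \<open>The code is unary, since the model sets no bound on the length of the stored
  strings.\<close>

definition decode :: "bool list \<Rightarrow> 'c::countable" where
  "decode bs = from_nat (length bs)"

lemma decode_encode [simp]: "decode (encode c) = c"
  by (simp add: encode_def decode_def)

text \<open>A timestamp with a copy of the states around the writer. The copy is a list rather than
  a function, so that snapshots form a countable type and can be encoded.\<close>

type_synonym 's snapshot = "nat \<times> (nat \<times> 's) list"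

definition unlabel :: "('i \<times> 'c) lgraph \<Rightarrow> 'i lgraph" where
  "unlabel W = \<lparr>nodes = nodes W, edges = edges W, label = (\<lambda>v. map_option fst (label W v))\<rparr>"

definition snapshots :: "('i \<times> ('o \<times> bool list) option) lgraph \<Rightarrow> nat \<rightharpoonup> ('s::countable) snapshot" where
  "snapshots W v = (case label W v of Some (i, Some (y, bs)) \<Rightarrow> Some (decode bs) | _ \<Rightarrow> None)"

text \<open>By symmetry of the graph these are the processed nodes whose snapshot covers
  \<open>u\<close>.\<close>

definition writers :: "nat \<Rightarrow> 'i lgraph \<Rightarrow> (nat \<rightharpoonup> 's snapshot) \<Rightarrow> nat \<Rightarrow> nat set" where
  "writers \<rho> G m u = hop_ball G \<rho> u \<inter> dom m"

definition latest :: "nat \<Rightarrow> 'i lgraph \<Rightarrow> (nat \<rightharpoonup> 's snapshot) \<Rightarrow> nat \<Rightarrow> nat \<Rightarrow> bool" where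
  "latest \<rho> G m u w \<longleftrightarrow> w \<in> writers \<rho> G m u \<and>
     (\<forall>w'\<in>writers \<rho> G m u. fst (the (m w')) \<le> fst (the (m w)))"

definition current :: "nat \<Rightarrow> 's \<Rightarrow> 'i lgraph \<Rightarrow> (nat \<rightharpoonup> 's snapshot) \<Rightarrow> nat \<Rightarrow> 's" where
  "current \<rho> s0 G m u = (if writers \<rho> G m u = {} then s0
     else the (map_of (snd (the (m (SOME w. latest \<rho> G m u w)))) u))"

text \<open>The timestamp put into a snapshot exceeds all timestamps in sight. Since any two writers of
  a node see each other, the largest timestamp among them marks the last write.\<close>

definition remote_step ::
  "nat \<Rightarrow> ('i lgraph \<Rightarrow> nat \<Rightarrow> (nat \<Rightarrow> 's) \<Rightarrow> nat \<Rightarrow> 's) \<Rightarrow> 's::countable \<Rightarrow> ('s \<Rightarrow> 'o) \<Rightarrow> nat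
     \<Rightarrow> ('i \<times> ('o \<times> bool list) option) lgraph \<Rightarrow> 'o \<times> bool list" where
  "remote_step \<rho> \<phi> s0 out v W =
     (let G = unlabel W; m = snapshots W; \<sigma> = \<phi> G v (current \<rho> s0 G m);
        t = Suc (Max (insert 0 ((\<lambda>w. fst (the (m w))) ` (nodes G \<inter> dom m))))
      in (out (\<sigma> v),
          encode (t, map (\<lambda>u. (u, \<sigma> u)) (sorted_list_of_set (hop_ball G \<rho> v)))))"

lemma unlabel_annotate [simp]: "unlabel (annotate G S) = G"
  by (rule lgraph.equality)
    (auto simp: unlabel_def option.map_comp comp_def option.map_ident fun_eq_iff)

definition memory :: "(nat \<rightharpoonup> 'o \<times> bool list) \<Rightarrow> nat \<rightharpoonup> ('s::countable) snapshot" where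
  "memory S w = map_option (decode \<circ> snd) (S w)"

lemma dom_memory [simp]: "dom (memory S) = dom S"
  by (auto simp: memory_def)

lemma snapshots_annotate_view:
  assumes "dom (label G) = nodes G" "edges G \<subseteq> nodes G \<times> nodes G" "v \<in> nodes G"
  shows "snapshots (annotate (view G R v) S) = memory S |` hop_ball G R v"
proof
  fix w
  show "snapshots (annotate (view G R v) S) w = (memory S |` hop_ball G R v) w"
  proof (cases "w \<in> hop_ball G R v")
    case True
    then have "w \<in> dom (label G)" using hop_ball_subset assms by blast
    then show ?thesis using True
      by (auto simp: snapshots_def memory_def split: option.split)
  qed (simp add: snapshots_def)
qed

text \<open>The simulation invariant: the memories \<open>m\<close> represent the global state
  \<open>\<sigma>\<close>. It speaks of every latest writer and so covers whichever one
  \<open>current\<close> picks.\<close>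

definition consistent ::
  "nat \<Rightarrow> 's \<Rightarrow> 'i lgraph \<Rightarrow> (nat \<rightharpoonup> ('s::countable) snapshot) \<Rightarrow> (nat \<Rightarrow> 's) \<Rightarrow> bool" where
  "consistent \<rho> s0 G m \<sigma> \<longleftrightarrow>
     (\<forall>u. (writers \<rho> G m u = {} \<longrightarrow> \<sigma> u = s0) \<and>
          (\<forall>w. latest \<rho> G m u w \<longrightarrow> map_of (snd (the (m w))) u = Some (\<sigma> u)))"

lemma current_eqI:
  assumes "finite (writers \<rho> G m u)" "writers \<rho> G m u = {} \<Longrightarrow> x = s0"
    "\<And>w. latest \<rho> G m u w \<Longrightarrow> map_of (snd (the (m w))) u = Some x"
  shows "current \<rho> s0 G m u = x"
proof (cases "writers \<rho> G m u = {}")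
  case False
  let ?t = "\<lambda>w. fst (the (m w))"
  have "Max (?t ` writers \<rho> G m u) \<in> ?t ` writers \<rho> G m u"
    using assms(1) False by (intro Max_in) auto
  then obtain w where "w \<in> writers \<rho> G m u" "?t w = Max (?t ` writers \<rho> G m u)" by auto
  then have "latest \<rho> G m u w" using assms(1) by (auto simp: latest_def)
  then have "latest \<rho> G m u (SOME w. latest \<rho> G m u w)" by (rule someI)
  then show ?thesis using assms(3) False by (simp add: current_def)
qed (use assms in \<open>auto simp: current_def\<close>)

text \<open>All writers of a node within \<open>\<rho>\<close> of \<open>v\<close> lie within
  \<open>2 * \<rho>\<close> of \<open>v\<close>, so the view of that radius shows the same writers
  as the whole graph.\<close>

lemma current_view:
  assumes cons: "consistent \<rho> s0 G m \<sigma>" and fin: "finite (dom m)" and u: "u \<in> hop_ball G \<rho> v"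
  shows "current \<rho> s0 (view G (2 * \<rho>) v) (m |` hop_ball G (2 * \<rho>) v) u = \<sigma> u"
proof (rule current_eqI)
  let ?H = "view G (2 * \<rho>) v" and ?m = "m |` hop_ball G (2 * \<rho>) v"
  have ball: "hop_ball ?H \<rho> u = hop_ball G \<rho> u"
    using u by (intro hop_ball_view) auto
  have sub: "hop_ball G \<rho> u \<subseteq> hop_ball G (2 * \<rho>) v"
    using hop_ball_trans[OF u] by auto
  have writers: "writers \<rho> ?H ?m u = writers \<rho> G m u"
    using sub by (auto simp: writers_def ball)
  have m: "?m w = m w" if "w \<in> writers \<rho> G m u" for w
    using that sub by (auto simp: writers_def)
  show "finite (writers \<rho> ?H ?m u)" using fin by (simp add: writers writers_def)
  show "\<sigma> u = s0" if "writers \<rho> ?H ?m u = {}"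
    using that cons unfolding writers consistent_def by blast
  show "map_of (snd (the (?m w))) u = Some (\<sigma> u)" if w: "latest \<rho> ?H ?m u w" for w
  proof -
    have "latest \<rho> G m u w" using w m unfolding latest_def writers by auto
    moreover have "?m w = m w" using w m unfolding latest_def writers by auto
    ultimately show ?thesis using cons unfolding consistent_def by simp
  qed
qed

text \<open>What the step reconstructs from its view is the represented state on the ball of radius
  \<open>\<rho>\<close>, and a local update reads nothing else.\<close>

lemma remote_step_view:
  fixes S :: "nat \<rightharpoonup> 'o \<times> bool list" and \<sigma> :: "nat \<Rightarrow> 's::countable"
  assumes \<phi>: "local_update \<rho> \<phi>" and G: "well_formed G" and v: "v \<in> nodes G"
    and cons: "consistent \<rho> s0 G (memory S) \<sigma>" and S: "finite (dom S)"
  obtains t where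
    "remote_step \<rho> \<phi> s0 out v (view (annotate G S) (2 * \<rho>) v) = (out (\<phi> G v \<sigma> v),
       encode (t, map (\<lambda>u. (u, \<phi> G v \<sigma> u)) (sorted_list_of_set (hop_ball G \<rho> v))))"
    "\<And>w. w \<in> hop_ball G (2 * \<rho>) v \<Longrightarrow> w \<in> dom S \<Longrightarrow>
       fst (the ((memory S :: nat \<rightharpoonup> 's snapshot) w)) < t"
proof -
  let ?H = "view G (2 * \<rho>) v"
  let ?mem = "memory S :: nat \<rightharpoonup> 's snapshot"
  let ?m = "?mem |` hop_ball G (2 * \<rho>) v"
  define t where "t = Suc (Max (insert 0 ((\<lambda>w. fst (the (?m w))) ` (nodes ?H \<inter> dom ?m))))"
  have m: "snapshots (annotate ?H S) = ?m"
    using G v by (intro snapshots_annotate_view) (auto simp: well_formed_def)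
  have ball: "hop_ball ?H \<rho> v = hop_ball G \<rho> v"
    by (rule hop_ball_view[where a = 0]) auto
  have "\<phi> ?H v (current \<rho> s0 ?H ?m) u = \<phi> G v \<sigma> u" if "u \<in> hop_ball G \<rho> v" for u
  proof (rule local_update_inside[OF \<phi>])
    show "view ?H \<rho> v = view G \<rho> v" by (rule view_view[where a = 0]) auto
    show "current \<rho> s0 ?H ?m w = \<sigma> w" if "w \<in> hop_ball ?H \<rho> v" for w
      using that ball by (intro current_view[OF cons]) (use S in auto)
  qed (use that ball in simp)
  then have upd: "map (\<lambda>u. (u, \<phi> ?H v (current \<rho> s0 ?H ?m) u)) (sorted_list_of_set (hop_ball G \<rho> v)) =
      map (\<lambda>u. (u, \<phi> G v \<sigma> u)) (sorted_list_of_set (hop_ball G \<rho> v))"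
    and out: "\<phi> ?H v (current \<rho> s0 ?H ?m) v = \<phi> G v \<sigma> v"
    using finite_hop_ball[OF G v] by simp_all
  have eq: "remote_step \<rho> \<phi> s0 out v (view (annotate G S) (2 * \<rho>) v) = (out (\<phi> G v \<sigma> v),
       encode (t, map (\<lambda>u. (u, \<phi> G v \<sigma> u)) (sorted_list_of_set (hop_ball G \<rho> v))))"
    unfolding remote_step_def Let_def view_annotate unlabel_annotate m t_def ball upd out ..
  have "fst (the (?mem w)) < t" if w: "w \<in> hop_ball G (2 * \<rho>) v" "w \<in> dom S" for w
  proof -
    have "fst (the (?mem w)) \<in> (\<lambda>w. fst (the (?m w))) ` (nodes ?H \<inter> dom ?m)"
      using w by (intro image_eqI[of _ _ w]) auto
    then show ?thesis using S unfolding t_def by (auto intro!: le_imp_less_Suc Max_ge)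
  qed
  with eq that show ?thesis by blast
qed

text \<open>If \<open>v\<close> covers \<open>u\<close>, any other writer of \<open>u\<close> is
  within \<open>2 * \<rho>\<close> of \<open>v\<close> and has a timestamp below \<open>t\<close>,
  so \<open>v\<close> is the only latest writer. If \<open>v\<close> does not cover
  \<open>u\<close>, neither the writers nor the state of \<open>u\<close> change.\<close>

lemma consistent_step:
  fixes m :: "nat \<rightharpoonup> ('s::countable) snapshot"
  assumes \<phi>: "local_update \<rho> \<phi>" and G: "well_formed G" and v: "v \<in> nodes G" "v \<notin> dom m"
    and cons: "consistent \<rho> s0 G m \<sigma>"
    and t: "\<And>w. w \<in> hop_ball G (2 * \<rho>) v \<Longrightarrow> w \<in> dom m \<Longrightarrow> fst (the (m w)) < t"
  shows "consistent \<rho> s0 G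
    (m(v \<mapsto> (t, map (\<lambda>u. (u, \<phi> G v \<sigma> u)) (sorted_list_of_set (hop_ball G \<rho> v))))) (\<phi> G v \<sigma>)"
    (is "consistent _ _ _ ?m ?\<sigma>")
proof -
  have sym: "sym (edges G)" using G by (simp add: well_formed_def)
  have "(writers \<rho> G ?m u = {} \<longrightarrow> ?\<sigma> u = s0) \<and>
      (\<forall>w. latest \<rho> G ?m u w \<longrightarrow> map_of (snd (the (?m w))) u = Some (?\<sigma> u))" for u
  proof (cases "u \<in> hop_ball G \<rho> v")
    case True
    then have "v \<in> hop_ball G \<rho> u" using hop_ball_sym[OF sym] by blast
    then have v_writes: "v \<in> writers \<rho> G ?m u" by (simp add: writers_def)
    have "w = v" if w: "latest \<rho> G ?m u w" for w
    proof (rule ccontr)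
      assume neq: "w \<noteq> v"
      then have "w \<in> hop_ball G \<rho> u" "w \<in> dom m" using w by (auto simp: latest_def writers_def)
      moreover have "w \<in> hop_ball G (2 * \<rho>) v"
        using hop_ball_trans[OF True \<open>w \<in> hop_ball G \<rho> u\<close>] by simp
      ultimately have "fst (the (m w)) < t" using t by blast
      moreover have "fst (the (?m v)) \<le> fst (the (?m w))" using w v_writes unfolding latest_def by blast
      ultimately show False using neq by simp
    qed
    moreover have "map_of (snd (the (?m v))) u = Some (?\<sigma> u)"
      using True finite_hop_ball[OF G v(1)]
      by (simp add: map_of_map_restrict[unfolded comp_def, of "\<lambda>u. ?\<sigma> u"])
    ultimately show ?thesis using v_writes by blast
  next
    case False
    then have nv: "v \<notin> hop_ball G \<rho> u" using hop_ball_sym[OF sym] by blast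
    then have writers: "writers \<rho> G ?m u = writers \<rho> G m u" by (auto simp: writers_def)
    have m: "?m w = m w" if "w \<in> writers \<rho> G m u" for w
      using that v by (auto simp: writers_def)
    have "latest \<rho> G ?m u w \<longleftrightarrow> latest \<rho> G m u w" for w
      unfolding latest_def writers by (auto simp: m simp del: fun_upd_apply)
    then show ?thesis
      using cons m local_update_outside[OF \<phi> False] unfolding consistent_def writers
      by (simp add: latest_def)
  qed
  then show ?thesis by (simp add: consistent_def)
qed

lemma slocal_run_remote_step:
  fixes s0 :: "'s::countable"
  assumes \<phi>: "local_update \<rho> \<phi>" and G: "well_formed G"
    and xs: "distinct xs" "set xs \<subseteq> nodes G"
  shows "consistent \<rho> s0 G (memory (slocal_run (remote_step \<rho> \<phi> s0 out) (2 * \<rho>) G xs))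
     (fold (\<phi> G) xs (\<lambda>_. s0))"
  using xs
proof (induction xs rule: rev_induct)
  case Nil
  have "memory Map.empty = Map.empty" by (simp add: memory_def fun_eq_iff)
  then show ?case by (simp add: consistent_def latest_def writers_def)
next
  case (snoc v xs)
  let ?S = "slocal_run (remote_step \<rho> \<phi> s0 out) (2 * \<rho>) G xs"
  let ?\<sigma> = "fold (\<phi> G) xs (\<lambda>_. s0)"
  let ?mem = "memory :: (nat \<rightharpoonup> 'b \<times> bool list) \<Rightarrow> nat \<rightharpoonup> 's snapshot"
  from snoc have cons: "consistent \<rho> s0 G (?mem ?S) ?\<sigma>" and v: "v \<in> nodes G" "v \<notin> set xs"
    by auto
  have fin: "finite (dom ?S)" by simp
  obtain t where step: "remote_step \<rho> \<phi> s0 out v (view (annotate G ?S) (2 * \<rho>) v) =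
      (out (\<phi> G v ?\<sigma> v),
       encode (t, map (\<lambda>u. (u, \<phi> G v ?\<sigma> u)) (sorted_list_of_set (hop_ball G \<rho> v))))"
    and t: "\<And>w. w \<in> hop_ball G (2 * \<rho>) v \<Longrightarrow> w \<in> dom ?S \<Longrightarrow> fst (the (?mem ?S w)) < t"
    by (rule remote_step_view[OF \<phi> G v(1) cons fin, where out = out]) blast
  have "?mem (slocal_run (remote_step \<rho> \<phi> s0 out) (2 * \<rho>) G (xs @ [v])) = (?mem ?S)(v \<mapsto>
      (t, map (\<lambda>u. (u, \<phi> G v ?\<sigma> u)) (sorted_list_of_set (hop_ball G \<rho> v))))"
    unfolding slocal_run_snoc step by (simp add: memory_def fun_eq_iff)
  moreover have "consistent \<rho> s0 G ((?mem ?S)(v \<mapsto>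
      (t, map (\<lambda>u. (u, \<phi> G v ?\<sigma> u)) (sorted_list_of_set (hop_ball G \<rho> v))))) (\<phi> G v ?\<sigma>)"
    using v t by (intro consistent_step[OF \<phi> G v(1) _ cons]) simp_all
  ultimately show ?case by (simp del: fun_upd_apply)
qed

text \<open>An output is committed when its node is processed, so it is read from the state after
  the prefix ending in \<open>v\<close> and not from the final state. The application must therefore
  ensure that later updates keep it.\<close>

lemma slocal_output_remote_step:
  fixes s0 :: "'s::countable"
  assumes \<phi>: "local_update \<rho> \<phi>" and G: "well_formed G"
    and xs: "distinct (xs @ v # ys)" "set (xs @ v # ys) \<subseteq> nodes G"
  shows "slocal_output (remote_step \<rho> \<phi> s0 out) (2 * \<rho>) G (xs @ v # ys) v =
    Some (out (fold (\<phi> G) (xs @ [v]) (\<lambda>_. s0) v))"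
proof -
  let ?run = "slocal_run (remote_step \<rho> \<phi> s0 out) (2 * \<rho>) G"
  have cons: "consistent \<rho> s0 G (memory (?run xs)) (fold (\<phi> G) xs (\<lambda>_. s0))"
    using xs by (intro slocal_run_remote_step[OF \<phi> G]) auto
  have fin: "finite (dom (?run xs))" and v: "v \<in> nodes G" using xs by simp_all
  have "fst (remote_step \<rho> \<phi> s0 out v (view (annotate G (?run xs)) (2 * \<rho>) v)) =
      out (\<phi> G v (fold (\<phi> G) xs (\<lambda>_. s0)) v)"
    by (rule remote_step_view[OF \<phi> G v cons fin, where out = out]) simp
  then have "map_option fst (?run (xs @ [v]) v) = Some (out (fold (\<phi> G) (xs @ [v]) (\<lambda>_. s0) v))"
    by (simp add: slocal_run_snoc)
  moreover have "?run (xs @ v # ys) v = ?run (xs @ [v]) v"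
    using slocal_run_prefix[of "xs @ [v]" ys v] xs(1) by simp
  ultimately show ?thesis by (simp add: slocal_output_def)
qed

section \<open>Carving clusters\<close>

text \<open>The state of a node: its current level, the centre of its cluster (once it has one) and the
  stored value forced upon the randomized algorithm at this node (once it is fixed).\<close>

type_synonym 'v node_state = "nat \<times> nat option \<times> 'v option"

abbreviation lev :: "(nat \<Rightarrow> 'v node_state) \<Rightarrow> nat \<Rightarrow> nat" where
  "lev \<sigma> u \<equiv> fst (\<sigma> u)"

abbreviation ctr :: "(nat \<Rightarrow> 'v node_state) \<Rightarrow> nat \<Rightarrow> nat option" where
  "ctr \<sigma> u \<equiv> fst (snd (\<sigma> u))"

abbreviation frc :: "(nat \<Rightarrow> 'v node_state) \<Rightarrow> nat \<Rightarrow> 'v option" where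
  "frc \<sigma> u \<equiv> snd (snd (\<sigma> u))"

text \<open>Radii grow in steps of \<open>r\<close>, so that every candidate within distance
  \<open>r\<close> of one ball belongs to the next ball.\<close>

definition growing :: "nat \<Rightarrow> 'i lgraph \<Rightarrow> nat \<Rightarrow> (nat \<Rightarrow> 'v node_state) \<Rightarrow> nat \<Rightarrow> nat set" where
  "growing r G w \<sigma> k = {u \<in> hop_ball G (k * r) w. ctr \<sigma> u = None \<and> lev \<sigma> u = lev \<sigma> w}"

lemma growing_subset: "k * r \<le> \<kappa> \<Longrightarrow> growing r G w \<sigma> k \<subseteq> hop_ball G \<kappa> w"
  unfolding growing_def using hop_ball_mono by blast

text \<open>The bound \<open>k < L\<close> keeps the ball with index \<open>Suc k\<close>, shell
  included, within distance \<open>L * r\<close>.\<close>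

definition stopping :: "nat \<Rightarrow> nat \<Rightarrow> 'i lgraph \<Rightarrow> nat \<Rightarrow> (nat \<Rightarrow> 'v node_state) \<Rightarrow> nat \<Rightarrow> bool" where
  "stopping r L G w \<sigma> k \<longleftrightarrow>
     k < L \<and> card (growing r G w \<sigma> (Suc k)) \<le> 2 * card (growing r G w \<sigma> k)"

definition carve ::
  "nat \<Rightarrow> nat \<Rightarrow> 'i lgraph \<Rightarrow> nat \<Rightarrow> (nat \<Rightarrow> 'v node_state) \<Rightarrow> nat \<Rightarrow> 'v node_state" where
  "carve r L G w \<sigma> = (let k = (SOME k. stopping r L G w \<sigma> k) in
     (\<lambda>u. if u \<in> growing r G w \<sigma> k then (lev \<sigma> u, Some w, frc \<sigma> u)
         else if u \<in> growing r G w \<sigma> (Suc k) then (Suc (lev \<sigma> u), None, frc \<sigma> u)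
         else \<sigma> u))"

text \<open>Once this holds, the node is never again an unclustered node of level below
  \<open>i\<close>; all actions preserve it (\<open>finished_act\<close>).\<close>

definition finished :: "nat \<Rightarrow> (nat \<Rightarrow> 'v node_state) \<Rightarrow> nat \<Rightarrow> bool" where
  "finished i \<sigma> u \<longleftrightarrow> ctr \<sigma> u \<noteq> None \<or> i \<le> lev \<sigma> u"

text \<open>Centres throughout distance \<open>\<rho>\<close> make the levels there final, and the
  choice of a value evaluates failure probabilities with these levels. Fixed predecessors determine
  what the randomized algorithm reads at \<open>w\<close>.\<close>

definition may_fix :: "nat \<Rightarrow> nat \<Rightarrow> 'i lgraph \<Rightarrow> nat \<Rightarrow> (nat \<Rightarrow> 'v node_state) \<Rightarrow> bool" where
  "may_fix r \<rho> G w \<sigma> \<longleftrightarrow> frc \<sigma> w = None \<and> (\<forall>u\<in>hop_ball G \<rho> w. ctr \<sigma> u \<noteq> None) \<and>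
     (\<forall>u\<in>hop_ball G r w. prec (lev \<sigma>) u w \<longrightarrow> frc \<sigma> u \<noteq> None)"

text \<open>A node carves only after all nodes within \<open>L * r\<close> have finished the levels
  below its own. Otherwise an unclustered node of lower level could lie next to the new cluster and
  enter its level later.\<close>

definition act ::
  "nat \<Rightarrow> nat \<Rightarrow> nat \<Rightarrow> ('i lgraph \<Rightarrow> nat \<Rightarrow> (nat \<Rightarrow> 'v node_state) \<Rightarrow> 'v)
     \<Rightarrow> 'i lgraph \<Rightarrow> nat \<Rightarrow> (nat \<Rightarrow> 'v node_state) \<Rightarrow> nat \<Rightarrow> 'v node_state" where
  "act r L \<rho> pick G w \<sigma> =
     (if ctr \<sigma> w = None
      then if (\<exists>k. stopping r L G w \<sigma> k) \<and> (\<forall>u\<in>hop_ball G (L * r) w. finished (lev \<sigma> w) \<sigma> u)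
        then carve r L G w \<sigma> else \<sigma>
      else if may_fix r \<rho> G w \<sigma> then \<sigma>(w := (lev \<sigma> w, ctr \<sigma> w, Some (pick G w \<sigma>))) else \<sigma>)"

definition masked :: "nat set \<Rightarrow> (nat \<Rightarrow> 's) \<Rightarrow> nat \<Rightarrow> 's" where
  "masked X \<sigma> = (\<lambda>w. if w \<in> X then \<sigma> w else undefined)"

text \<open>Guards and carving read and write only within \<open>\<rho>\<close>, so localizing
  leaves them unchanged and merely makes \<open>pick\<close> work on the masked view.\<close>

lemma localize_act:
  assumes le: "L * r \<le> \<rho>" "r \<le> \<rho>"
  shows "localize \<rho> (act r L \<rho> pick) G w \<sigma> =
    act r L \<rho> (\<lambda>G w \<sigma>. pick (view G \<rho> w) w (masked (hop_ball G \<rho> w) \<sigma>)) G w \<sigma>"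
proof -
  let ?H = "view G \<rho> w" and ?\<tau> = "masked (hop_ball G \<rho> w) \<sigma>"
  have ball: "hop_ball ?H k w = hop_ball G k w" if "k \<le> \<rho>" for k
    using that by (intro hop_ball_view[where a = 0]) auto
  have \<tau>: "?\<tau> u = \<sigma> u" if "u \<in> hop_ball G k w" "k \<le> \<rho>" for u k
    using hop_ball_mono[OF that] by (simp add: masked_def)
  have \<tau>w: "?\<tau> w = \<sigma> w" by (simp add: masked_def)
  have Lr: "k * r \<le> \<rho>" if "k \<le> L" for k
    using that le(1) by (meson mult_le_mono1 order_trans)
  have growing: "growing r ?H w ?\<tau> k = growing r G w \<sigma> k" if "k \<le> L" for k
    using \<tau>[of _ "k * r"] \<tau>w Lr[OF that] by (auto simp: growing_def ball)
  have stopping: "stopping r L ?H w ?\<tau> = stopping r L G w \<sigma>"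
    by (auto simp: stopping_def growing fun_eq_iff)
  have carve: "carve r L ?H w ?\<tau> u = carve r L G w \<sigma> u"
    if ex: "\<exists>k. stopping r L G w \<sigma> k" and u: "u \<in> hop_ball G \<rho> w" for u
  proof -
    have "(SOME k. stopping r L G w \<sigma> k) < L"
      using someI_ex[OF ex] by (simp add: stopping_def)
    then show ?thesis
      unfolding carve_def Let_def stopping using \<tau>[OF u] by (simp add: growing)
  qed
  have outside: "carve r L G w \<sigma> u = \<sigma> u"
    if ex: "\<exists>k. stopping r L G w \<sigma> k" and u: "u \<notin> hop_ball G \<rho> w" for u
  proof -
    have "(SOME k. stopping r L G w \<sigma> k) < L"
      using someI_ex[OF ex] by (simp add: stopping_def)
    then have "u \<notin> growing r G w \<sigma> (SOME k. stopping r L G w \<sigma> k)"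
      "u \<notin> growing r G w \<sigma> (Suc (SOME k. stopping r L G w \<sigma> k))"
      using u growing_subset[of _ r \<rho> G w \<sigma>] Lr by (metis Suc_leI less_imp_le_nat subsetD)+
    then show ?thesis by (simp add: carve_def Let_def)
  qed
  have finished: "finished i ?\<tau> u \<longleftrightarrow> finished i \<sigma> u" if "u \<in> hop_ball G (L * r) w" for i u
    using \<tau>[OF that le(1)] by (simp add: finished_def)
  have may_fix: "may_fix r \<rho> ?H w ?\<tau> \<longleftrightarrow> may_fix r \<rho> G w \<sigma>"
    using \<tau>[of _ \<rho>] \<tau>[of _ r] \<tau>w le(2) by (simp add: may_fix_def ball prec_def)
  show ?thesis
  proof
    fix u
    show "localize \<rho> (act r L \<rho> pick) G w \<sigma> u =
      act r L \<rho> (\<lambda>G w \<sigma>. pick (view G \<rho> w) w (masked (hop_ball G \<rho> w) \<sigma>)) G w \<sigma> u"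
    proof (cases "u \<in> hop_ball G \<rho> w")
      case True
      then show ?thesis
        unfolding localize_def act_def masked_def[symmetric]
        by (auto simp: \<tau>w stopping ball[OF le(1)] finished may_fix carve \<tau>[OF True order_refl])
    next
      case False
      then have "u \<noteq> w" by auto
      with False show ?thesis
        unfolding localize_def act_def masked_def[symmetric] by (simp add: outside)
    qed
  qed
qed

lemma act_mono:
  "ctr \<sigma> u \<noteq> None \<Longrightarrow> ctr (act r L \<rho> pick G w \<sigma>) u = ctr \<sigma> u"
  "ctr \<sigma> u \<noteq> None \<Longrightarrow> lev (act r L \<rho> pick G w \<sigma>) u = lev \<sigma> u"
  "lev \<sigma> u \<le> lev (act r L \<rho> pick G w \<sigma>) u"
  "frc \<sigma> u \<noteq> None \<Longrightarrow> frc (act r L \<rho> pick G w \<sigma>) u = frc \<sigma> u"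
  by (auto simp: act_def carve_def growing_def may_fix_def Let_def)

lemma finished_act: "finished i \<sigma> u \<Longrightarrow> finished i (act r L \<rho> pick G w \<sigma>) u"
  using act_mono[of \<sigma> u r L \<rho> pick G w] unfolding finished_def by (metis order_trans)

section \<open>The clustering invariant\<close>

text \<open>The third condition bounds the number of nodes passed on to later levels; the fourth keeps
  nodes of the same level that are still undecided away from the existing clusters.\<close>

definition clustering ::
  "nat \<Rightarrow> nat \<Rightarrow> 'i lgraph \<Rightarrow> (nat \<Rightarrow> 'v node_state) \<Rightarrow> bool" where
  "clustering r \<kappa> G \<sigma> \<longleftrightarrow>
     (\<forall>u\<in>nodes G. \<forall>c. ctr \<sigma> u = Some c \<longrightarrow> u \<in> hop_ball G \<kappa> c) \<and>
     (\<forall>u\<in>nodes G. \<forall>w\<in>hop_ball G r u. ctr \<sigma> u \<noteq> None \<longrightarrow> ctr \<sigma> w \<noteq> None \<longrightarrow> lev \<sigma> u = lev \<sigma> w \<longrightarrow>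
        ctr \<sigma> u = ctr \<sigma> w) \<and>
     (\<forall>i. card {u \<in> nodes G. i < lev \<sigma> u} \<le> card {u \<in> nodes G. lev \<sigma> u = i \<and> ctr \<sigma> u \<noteq> None}) \<and>
     (\<forall>u\<in>nodes G. \<forall>w\<in>hop_ball G r u. ctr \<sigma> u \<noteq> None \<longrightarrow> ctr \<sigma> w = None \<longrightarrow> lev \<sigma> u < lev \<sigma> w)"

lemma clusteringD:
  assumes "clustering r \<kappa> G \<sigma>" "u \<in> nodes G"
  shows "ctr \<sigma> u = Some c \<Longrightarrow> u \<in> hop_ball G \<kappa> c"
    and "w \<in> hop_ball G r u \<Longrightarrow> ctr \<sigma> u \<noteq> None \<Longrightarrow> ctr \<sigma> w \<noteq> None \<Longrightarrow> lev \<sigma> u = lev \<sigma> w \<Longrightarrow>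
      ctr \<sigma> u = ctr \<sigma> w"
    and "card {u \<in> nodes G. i < lev \<sigma> u} \<le> card {u \<in> nodes G. lev \<sigma> u = i \<and> ctr \<sigma> u \<noteq> None}"
    and "w \<in> hop_ball G r u \<Longrightarrow> ctr \<sigma> u \<noteq> None \<Longrightarrow> ctr \<sigma> w = None \<Longrightarrow> lev \<sigma> u < lev \<sigma> w"
  using assms unfolding clustering_def by blast+

lemma clustering_init: "clustering r \<kappa> G (\<lambda>_. (0, None, None))"
  by (simp add: clustering_def)

lemma clustering_cong:
  "(\<And>u. lev \<tau> u = lev \<sigma> u) \<Longrightarrow> (\<And>u. ctr \<tau> u = ctr \<sigma> u) \<Longrightarrow>
   clustering r \<kappa> G \<tau> \<longleftrightarrow> clustering r \<kappa> G \<sigma>"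
  unfolding clustering_def by simp

text \<open>By the third condition the nodes above level \<open>i\<close> are at most as many as
  those clustered at level \<open>i\<close>. Hence the number of nodes of level at least
  \<open>i\<close> halves with each \<open>i\<close>, and none is left at \<open>L\<close>.\<close>

lemma lev_bound:
  assumes "clustering r \<kappa> G \<sigma>" "finite (nodes G)" "card (nodes G) < 2 ^ L" "u \<in> nodes G"
  shows "lev \<sigma> u < L"
proof -
  let ?U = "\<lambda>i. {u \<in> nodes G. i \<le> lev \<sigma> u}"
  have "card (?U i) * 2 ^ i \<le> card (nodes G)" for i
  proof (induction i)
    case (Suc i)
    have "?U (Suc i) = {u \<in> nodes G. i < lev \<sigma> u}" by auto
    then have "2 * card (?U (Suc i)) \<le>
        card (?U (Suc i)) + card {u \<in> nodes G. lev \<sigma> u = i \<and> ctr \<sigma> u \<noteq> None}"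
      using clusteringD(3)[OF assms(1,4), of i] by simp
    also have "\<dots> = card (?U (Suc i) \<union> {u \<in> nodes G. lev \<sigma> u = i \<and> ctr \<sigma> u \<noteq> None})"
      using assms(2) by (intro card_Un_disjoint[symmetric]) auto
    also have "\<dots> \<le> card (?U i)" using assms(2) by (intro card_mono) auto
    finally have "2 * card (?U (Suc i)) * 2 ^ i \<le> card (?U i) * 2 ^ i" by (rule mult_le_mono1)
    also note Suc
    finally show ?case by (simp add: ac_simps)
  qed (simp add: card_mono assms(2))
  note bound = this[of L]
  show ?thesis
  proof (rule ccontr)
    assume "\<not> lev \<sigma> u < L"
    then have "u \<in> ?U L" using assms(4) by simp
    then have "0 < card (?U L)" using assms(2) card_gt_0_iff by fastforce
    then have "1 * 2 ^ L \<le> card (?U L) * 2 ^ L" by (intro mult_le_mono1) simp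
    also note bound
    also note assms(3)
    finally show False by simp
  qed
qed

text \<open>Otherwise the ball, starting from the single node \<open>w\<close>, would double
  \<open>L\<close> times and outgrow the graph.\<close>

lemma ex_stopping:
  assumes G: "well_formed G" "card (nodes G) < 2 ^ L" and w: "w \<in> nodes G" "ctr \<sigma> w = None"
  shows "\<exists>k. stopping r L G w \<sigma> k"
proof (rule ccontr)
  assume *: "\<nexists>k. stopping r L G w \<sigma> k"
  have fin: "finite (growing r G w \<sigma> k)" for k
    using finite_hop_ball[OF G(1) w(1)] by (simp add: growing_def)
  have "2 ^ k \<le> card (growing r G w \<sigma> k)" if "k \<le> L" for k
    using that
  proof (induction k)
    case 0
    have "growing r G w \<sigma> 0 = {w}" using w by (auto simp: growing_def)
    then show ?case by simp
  next
    case (Suc k)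
    have "2 * card (growing r G w \<sigma> k) < card (growing r G w \<sigma> (Suc k))"
      using Suc.prems * by (auto simp: stopping_def not_le)
    with Suc show ?case by simp
  qed
  then have "2 ^ L \<le> card (growing r G w \<sigma> L)" by simp
  also have "\<dots> \<le> card (nodes G)"
    using G w hop_ball_subset[of G w]
    by (intro card_mono) (auto simp: growing_def well_formed_def)
  finally show False using G by simp
qed

lemma clustering_carve:
  assumes G: "well_formed G" and w: "w \<in> nodes G" "ctr \<sigma> w = None"
    and \<sigma>: "clustering r (L * r) G \<sigma>" and ex: "\<exists>k. stopping r L G w \<sigma> k"
    and guard: "\<And>u. u \<in> hop_ball G (L * r) w \<Longrightarrow> finished (lev \<sigma> w) \<sigma> u"
  shows "clustering r (L * r) G (carve r L G w \<sigma>)"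
proof -
  define k where "k = (SOME k. stopping r L G w \<sigma> k)"
  let ?N = "growing r G w \<sigma> k" and ?N' = "growing r G w \<sigma> (Suc k)"
  let ?\<tau> = "carve r L G w \<sigma>"
  have k: "k < L" "card ?N' \<le> 2 * card ?N"
    using someI_ex[OF ex] by (simp_all add: k_def stopping_def)
  have sub: "?N \<subseteq> ?N'" by (auto simp: growing_def intro: hop_ball_mono)
  have "Suc k * r \<le> L * r" using k(1) by (intro mult_le_mono1) simp
  then have N'_ball: "?N' \<subseteq> hop_ball G (L * r) w" by (rule growing_subset)
  have fin: "finite (nodes G)" and sym: "sym (edges G)" and E: "edges G \<subseteq> nodes G \<times> nodes G"
    using G by (simp_all add: well_formed_def)
  have N'_nodes: "?N' \<subseteq> nodes G"
    using hop_ball_subset[OF E w(1)] by (auto simp: growing_def)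
  then have fin': "finite ?N'" using fin finite_subset by blast
  have lev: "lev ?\<tau> u = (if u \<in> ?N' - ?N then Suc (lev \<sigma> w) else lev \<sigma> u)" for u
    by (auto simp: carve_def Let_def k_def[symmetric] growing_def)
  have ctr: "ctr ?\<tau> u = (if u \<in> ?N then Some w else ctr \<sigma> u)" for u
    by (auto simp: carve_def Let_def k_def[symmetric] growing_def)
  have N: "ctr \<sigma> u = None" "lev \<sigma> u = lev \<sigma> w" if "u \<in> ?N'" for u
    using that by (auto simp: growing_def)
  \<comment> \<open>The guard enters here: an unclustered node within \<open>r\<close> of the new
    cluster lies within the next radius and has level at least \<open>lev \<sigma> w\<close>; if the
    level is equal, the node is in the shell and gets promoted.\<close>
  have near: "lev \<sigma> w < lev ?\<tau> v" if u: "u \<in> ?N" and v: "v \<in> hop_ball G r u" "ctr ?\<tau> v = None" for u v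
  proof -
    have "v \<in> hop_ball G (Suc k * r) w"
      using u v(1) by (auto simp: growing_def intro: hop_ball_trans)
    moreover from this have "finished (lev \<sigma> w) \<sigma> v"
      using guard hop_ball_mono \<open>Suc k * r \<le> L * r\<close> by blast
    moreover have "v \<notin> ?N" "ctr \<sigma> v = None" using v(2) unfolding ctr by (auto split: if_splits)
    ultimately show ?thesis unfolding lev by (auto simp: growing_def finished_def)
  qed
  \<comment> \<open>By the fourth condition, older clusters next to carved nodes have strictly
    smaller level, so the new cluster meets none of them on its own level.\<close>
  have near': "lev \<sigma> v < lev \<sigma> u"
    if "u \<in> ?N'" "v \<in> nodes G" "v \<in> hop_ball G r u" "ctr \<sigma> v \<noteq> None" for u v
    using clusteringD(4)[OF \<sigma> that(2) _ that(4)] N(1)[OF that(1)] that(3) hop_ball_sym[OF sym] by blast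
  show ?thesis
    unfolding clustering_def
  proof (intro conjI ballI allI impI)
    fix u c assume "u \<in> nodes G" "ctr ?\<tau> u = Some c"
    then show "u \<in> hop_ball G (L * r) c"
      using clusteringD(1)[OF \<sigma>] N'_ball sub unfolding ctr by (auto split: if_splits)
  next
    fix u v assume u: "u \<in> nodes G" and v: "v \<in> hop_ball G r u"
      and *: "ctr ?\<tau> u \<noteq> None" "ctr ?\<tau> v \<noteq> None" "lev ?\<tau> u = lev ?\<tau> v"
    have vn: "v \<in> nodes G" using hop_ball_subset[OF E u] v by blast
    have nD: "u \<notin> ?N' - ?N" "v \<notin> ?N' - ?N" using * N(1) unfolding ctr by (auto split: if_splits)
    then have "lev \<sigma> u = lev \<sigma> v" using *(3) unfolding lev by (auto split: if_splits)
    then show "ctr ?\<tau> u = ctr ?\<tau> v"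
      using near'[of u v] near'[of v u] clusteringD(2)[OF \<sigma> u v] u v vn sub *(1,2)
        hop_ball_sym[OF sym v] unfolding ctr by (auto split: if_splits)
  next
    fix u v assume u: "u \<in> nodes G" and v: "v \<in> hop_ball G r u"
      and *: "ctr ?\<tau> u \<noteq> None" "ctr ?\<tau> v = None"
    show "lev ?\<tau> u < lev ?\<tau> v"
    proof (cases "u \<in> ?N")
      case True
      then show ?thesis using near[OF True v *(2)] N(2) sub lev by auto
    next
      case False
      then have "ctr \<sigma> u \<noteq> None" "u \<notin> ?N'" using *(1) N(1) unfolding ctr by auto
      moreover have "ctr \<sigma> v = None" using *(2) unfolding ctr by (auto split: if_splits)
      ultimately have "lev \<sigma> u < lev \<sigma> v" using clusteringD(4)[OF \<sigma> u v] by blast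
      then show ?thesis using \<open>u \<notin> ?N'\<close> N(2)[of v] unfolding lev by auto
    qed
  next
    fix i
    show "card {u \<in> nodes G. i < lev ?\<tau> u} \<le> card {u \<in> nodes G. lev ?\<tau> u = i \<and> ctr ?\<tau> u \<noteq> None}"
    proof (cases "i = lev \<sigma> w")
      case True
      \<comment> \<open>The shell raises the left-hand count by at most \<open>card ?N\<close>, by
        the stopping rule, and the new cluster raises the right-hand count by at least that
        much.\<close>
      have "{u \<in> nodes G. i < lev ?\<tau> u} = {u \<in> nodes G. i < lev \<sigma> u} \<union> (?N' - ?N)"
        using N'_nodes N(2) True unfolding lev by (auto split: if_splits)
      then have "card {u \<in> nodes G. i < lev ?\<tau> u} \<le> card {u \<in> nodes G. i < lev \<sigma> u} + card (?N' - ?N)"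
        using card_Un_le by simp
      also have "card (?N' - ?N) \<le> card ?N"
        using card_Diff_subset[OF finite_subset[OF sub fin'] sub] k(2) by simp
      also have "card {u \<in> nodes G. i < lev \<sigma> u} + card ?N \<le>
          card {u \<in> nodes G. lev \<sigma> u = i \<and> ctr \<sigma> u \<noteq> None} + card ?N"
        using clusteringD(3)[OF \<sigma> w(1)] by simp
      also have "\<dots> = card ({u \<in> nodes G. lev \<sigma> u = i \<and> ctr \<sigma> u \<noteq> None} \<union> ?N)"
        using fin finite_subset[OF sub fin'] N(1) sub by (intro card_Un_disjoint[symmetric]) auto
      also have "\<dots> \<le> card {u \<in> nodes G. lev ?\<tau> u = i \<and> ctr ?\<tau> u \<noteq> None}"
        using fin N N'_nodes sub True unfolding lev ctr by (intro card_mono) auto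
      finally show ?thesis by simp
    next
      case False
      \<comment> \<open>Promotion from \<open>lev \<sigma> w\<close> to its successor crosses no
        other threshold.\<close>
      have "{u \<in> nodes G. i < lev ?\<tau> u} = {u \<in> nodes G. i < lev \<sigma> u}"
        using N(2) False unfolding lev by (auto split: if_splits)
      moreover have "{u \<in> nodes G. lev ?\<tau> u = i \<and> ctr ?\<tau> u \<noteq> None} =
          {u \<in> nodes G. lev \<sigma> u = i \<and> ctr \<sigma> u \<noteq> None}"
        using N sub False unfolding lev ctr by (auto split: if_splits)
      ultimately show ?thesis using clusteringD(3)[OF \<sigma> w(1), of i] by simp
    qed
  qed
qed

lemma clustering_act:
  assumes "well_formed G" "w \<in> nodes G" "clustering r (L * r) G \<sigma>"
  shows "clustering r (L * r) G (act r L \<rho> pick G w \<sigma>)"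
proof -
  have "clustering r (L * r) G (\<sigma>(w := (lev \<sigma> w, ctr \<sigma> w, x)))" for x
    using assms(3) by (subst clustering_cong) auto
  then show ?thesis
    using clustering_carve[OF assms(1,2) _ assms(3)] assms(3) by (auto simp: act_def)
qed

text \<open>An unclustered \<open>w\<close> of level \<open>i\<close> passes its guard, has a
  stopping radius by \<open>ex_stopping\<close>, and belongs to the cluster it carves. In all other
  cases it has already finished.\<close>

lemma finished_Suc_act:
  assumes G: "well_formed G" "card (nodes G) < 2 ^ L" and w: "w \<in> nodes G"
    and "\<And>u. u \<in> hop_ball G (L * r) w \<Longrightarrow> finished i \<sigma> u"
  shows "finished (Suc i) (act r L \<rho> pick G w \<sigma>) w"
proof (cases "ctr \<sigma> w = None \<and> lev \<sigma> w = i")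
  case True
  then have "w \<in> growing r G w \<sigma> k" for k by (simp add: growing_def)
  then have "ctr (carve r L G w \<sigma>) w = Some w" by (simp add: carve_def Let_def)
  then show ?thesis
    using True assms(4) ex_stopping[OF G w] by (auto simp: act_def finished_def)
next
  case False
  moreover have "finished i \<sigma> w" using assms(4) by simp
  ultimately have "finished (Suc i) \<sigma> w" by (auto simp: finished_def)
  then show ?thesis by (rule finished_act)
qed

section \<open>Progress and dependency chains\<close>

text \<open>Split the list at \<open>w\<close>: the invariant \<open>I\<close> lasts until there,
  \<open>w\<close> establishes \<open>P\<close>, and \<open>P\<close> is permanent.\<close>

lemma fold_progress:
  assumes I: "I \<sigma>" "\<And>x \<sigma>. x \<in> set xs \<Longrightarrow> I \<sigma> \<Longrightarrow> I (f x \<sigma>)"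
    and P: "\<And>\<sigma>. I \<sigma> \<Longrightarrow> P (f w \<sigma>)" "\<And>x \<sigma>. P \<sigma> \<Longrightarrow> P (f x \<sigma>)"
    and w: "w \<in> set xs"
  shows "P (fold f xs \<sigma>)"
proof -
  obtain ys zs where xs: "xs = ys @ w # zs" using w by (meson split_list)
  have "I (fold f ys \<sigma>)"
    by (rule fold_invariant[where P = I and Q = "\<lambda>x. x \<in> set xs"]) (auto simp: I xs)
  then have *: "P (f w (fold f ys \<sigma>))" by (rule P(1))
  have "P (fold f zs (f w (fold f ys \<sigma>)))"
    by (rule fold_invariant[where P = P and Q = "\<lambda>_. True"]) (auto simp: P(2) *)
  then show ?thesis by (simp add: xs)
qed

lemma fold_concat_replicate: "fold f (concat (replicate N xs)) = fold f xs ^^ N"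
proof (induction N)
  case (Suc N)
  then show ?case by (simp add: fold_append funpow_Suc_right del: funpow.simps(2))
qed (simp add: id_def)

lemma funpow_invariant: "(\<And>\<sigma>. I \<sigma> \<Longrightarrow> I (f \<sigma>)) \<Longrightarrow> I \<sigma> \<Longrightarrow> I ((f ^^ N) \<sigma>)"
  by (induction N) auto

text \<open>The nodes whose stored values can influence the one at \<open>v\<close> when the
  algorithm runs in the order \<open>prec lv\<close>.\<close>

definition deps :: "nat \<Rightarrow> 'i lgraph \<Rightarrow> (nat \<Rightarrow> nat) \<Rightarrow> nat \<Rightarrow> nat set" where
  "deps r G lv v = {u. (v, u) \<in> {(a, b). b \<in> hop_ball G r a \<and> prec lv b a}\<^sup>*}"

lemma deps_self [simp]: "v \<in> deps r G lv v"
  by (simp add: deps_def)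

lemma deps_step: "u \<in> deps r G lv v \<Longrightarrow> w \<in> hop_ball G r u \<Longrightarrow> prec lv w u \<Longrightarrow> w \<in> deps r G lv v"
  unfolding deps_def mem_Collect_eq by (rule rtrancl_into_rtrancl) auto

text \<open>Along a dependency chain the level never increases, and while it is constant the chain stays
  in one cluster.\<close>

lemma deps_near:
  assumes G: "well_formed G" "card (nodes G) < 2 ^ L" and \<sigma>: "clustering r \<kappa> G \<sigma>"
    and v: "v \<in> nodes G"
    and ctr: "\<And>u. u \<in> hop_ball G (L * (2 * \<kappa> + r) + r) v \<Longrightarrow> ctr \<sigma> u \<noteq> None"
    and u: "u \<in> deps r G (lev \<sigma>) v"
  shows "u \<in> hop_ball G (L * (2 * \<kappa> + r)) v"
proof -
  let ?M = "2 * \<kappa> + r"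
  have fin: "finite (nodes G)" and sym: "sym (edges G)" and E: "edges G \<subseteq> nodes G \<times> nodes G"
    using G by (simp_all add: well_formed_def)
  \<comment> \<open>Distance is measured at cluster centres. A move to a lower level costs
    \<open>\<kappa>\<close> from the old centre, \<open>r\<close> for the hop and
    \<open>\<kappa>\<close> to the new centre, in total \<open>?M\<close>; a move inside a cluster
    costs nothing.\<close>
  define near where "near u \<longleftrightarrow> u \<in> nodes G \<and> lev \<sigma> u \<le> lev \<sigma> v \<and>
    (\<exists>c. ctr \<sigma> u = Some c \<and> c \<in> hop_ball G ((lev \<sigma> v - lev \<sigma> u) * ?M + \<kappa>) v)" for u
  \<comment> \<open>As \<open>lev \<sigma> v < L\<close>, there is room for one more
    \<open>?M\<close>, which pays for the way from \<open>v\<close> to its own centre and from the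
    last centre to \<open>u\<close>.\<close>
  have le: "(lev \<sigma> v - i) * ?M + 2 * \<kappa> \<le> L * ?M" for i
  proof -
    have "Suc (lev \<sigma> v - i) \<le> L" using lev_bound[OF \<sigma> fin G(2) v] by linarith
    then have "Suc (lev \<sigma> v - i) * ?M \<le> L * ?M" by (rule mult_le_mono1)
    then show ?thesis by simp
  qed
  have ball: "u \<in> hop_ball G (L * ?M) v" if near_u: "near u" for u
  proof -
    obtain c where c: "ctr \<sigma> u = Some c" "c \<in> hop_ball G ((lev \<sigma> v - lev \<sigma> u) * ?M + \<kappa>) v"
      using near_u unfolding near_def by blast
    then have "u \<in> hop_ball G \<kappa> c" using clusteringD(1)[OF \<sigma>] near_u by (auto simp: near_def)
    then show ?thesis using hop_ball_trans[OF c(2)] le[of "lev \<sigma> u"] by simp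
  qed
  have near_step: "near w" if u: "near u" and w: "w \<in> hop_ball G r u" "prec (lev \<sigma>) w u" for u w
  proof -
    have un: "u \<in> nodes G" and wn: "w \<in> nodes G"
      using u w(1) hop_ball_subset[OF E] by (auto simp: near_def)
    obtain c where c: "ctr \<sigma> u = Some c" "c \<in> hop_ball G ((lev \<sigma> v - lev \<sigma> u) * ?M + \<kappa>) v"
      and lu: "lev \<sigma> u \<le> lev \<sigma> v" using u unfolding near_def by blast
    \<comment> \<open>The extra \<open>r\<close> in the hypothesis on \<open>ctr\<close> provides a
      centre for the next node of the chain before that node is known to be near.\<close>
    have "w \<in> hop_ball G (L * ?M + r) v" using hop_ball_trans[OF ball[OF u] w(1)] by simp
    then obtain c' where c': "ctr \<sigma> w = Some c'" using ctr by blast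
    show ?thesis
    proof (cases "lev \<sigma> w = lev \<sigma> u")
      case True
      then have "c' = c" using clusteringD(2)[OF \<sigma> un w(1)] c c' by simp
      then show ?thesis using c c' lu wn True by (simp add: near_def)
    next
      case False
      then have lw: "lev \<sigma> w < lev \<sigma> u" using w(2) by (auto simp: prec_def)
      have "u \<in> hop_ball G \<kappa> c" using clusteringD(1)[OF \<sigma> un c(1)] .
      then have "w \<in> hop_ball G (\<kappa> + r) c" using hop_ball_trans[OF _ w(1)] by simp
      moreover have "c' \<in> hop_ball G \<kappa> w"
        using clusteringD(1)[OF \<sigma> wn c'] hop_ball_sym[OF sym] by blast
      ultimately have "c' \<in> hop_ball G ?M c" by (rule hop_ball_trans) simp
      then have "c' \<in> hop_ball G (Suc (lev \<sigma> v - lev \<sigma> u) * ?M + \<kappa>) v"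
        using hop_ball_trans[OF c(2)] by simp
      moreover have "Suc (lev \<sigma> v - lev \<sigma> u) * ?M \<le> (lev \<sigma> v - lev \<sigma> w) * ?M"
        using lw lu by (intro mult_le_mono1) linarith
      ultimately have "c' \<in> hop_ball G ((lev \<sigma> v - lev \<sigma> w) * ?M + \<kappa>) v"
        using hop_ball_mono by (meson add_le_mono1)
      then show ?thesis using c' wn lw lu by (simp add: near_def)
    qed
  qed
  have near_v: "near v"
  proof -
    obtain c where c: "ctr \<sigma> v = Some c" using ctr[of v] by auto
    then show ?thesis
      using v clusteringD(1)[OF \<sigma> v c] hop_ball_sym[OF sym] by (auto simp: near_def)
  qed
  have "near u" if "(v, u) \<in> {(a, b). b \<in> hop_ball G r a \<and> prec (lev \<sigma>) b a}\<^sup>*"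
    using that
  proof (induction rule: rtrancl_induct)
    case (step u w)
    then show ?case using near_step by blast
  qed (rule near_v)
  then show ?thesis using u ball by (simp add: deps_def)
qed

lemma clustering_fold_act:
  "well_formed G \<Longrightarrow> set ws \<subseteq> nodes G \<Longrightarrow> clustering r (L * r) G \<sigma> \<Longrightarrow>
   clustering r (L * r) G (fold (act r L \<rho> pick G) ws \<sigma>)"
  by (induction ws arbitrary: \<sigma>) (auto simp: clustering_act)

lemma fold_act_mono:
  "ctr \<sigma> u \<noteq> None \<Longrightarrow> ctr (fold (act r L \<rho> pick G) ws \<sigma>) u = ctr \<sigma> u"
  "ctr \<sigma> u \<noteq> None \<Longrightarrow> lev (fold (act r L \<rho> pick G) ws \<sigma>) u = lev \<sigma> u"
  "frc \<sigma> u \<noteq> None \<Longrightarrow> frc (fold (act r L \<rho> pick G) ws \<sigma>) u = frc \<sigma> u"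
  by (induction ws arbitrary: \<sigma>) (simp_all add: act_mono)

section \<open>Repeated sweeps over a ball\<close>

context
  fixes r L \<rho> Q :: nat and G :: "'i lgraph" and v :: nat
    and pick :: "'i lgraph \<Rightarrow> nat \<Rightarrow> (nat \<Rightarrow> 'v node_state) \<Rightarrow> 'v" and ws :: "nat list"
  assumes G: "well_formed G" "card (nodes G) < 2 ^ L" and v: "v \<in> nodes G"
    and ws: "set ws = hop_ball G Q v"
begin

private abbreviation sweep :: "nat \<Rightarrow> (nat \<Rightarrow> 'v node_state) \<Rightarrow> nat \<Rightarrow> 'v node_state" where
  "sweep j \<equiv> fold (act r L \<rho> pick G) ws ^^ j"

lemma ball_nodes: "hop_ball G Q v \<subseteq> nodes G"
  using G v hop_ball_subset[of G v] by (simp add: well_formed_def)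

lemma clustering_sweep: "clustering r (L * r) G \<sigma> \<Longrightarrow> clustering r (L * r) G (sweep j \<sigma>)"
  using G ws ball_nodes
  by (intro funpow_invariant[where I = "clustering r (L * r) G"] clustering_fold_act) auto

text \<open>The guard looks \<open>L * r\<close> far, so each sweep shrinks the region of known
  progress by that margin.\<close>

lemma finished_sweep:
  assumes \<sigma>: "clustering r (L * r) G \<sigma>"
  shows "j * (L * r) \<le> Q \<Longrightarrow> u \<in> hop_ball G (Q - j * (L * r)) v \<Longrightarrow> finished j (sweep j \<sigma>) u"
proof (induction j arbitrary: u)
  case (Suc j)
  have "finished (Suc j) (fold (act r L \<rho> pick G) ws (sweep j \<sigma>)) u"
  proof (rule fold_progress[where w = u and I = "\<lambda>\<tau>. \<forall>x\<in>hop_ball G (L * r) u. finished j \<tau> x"])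
    show "\<forall>x\<in>hop_ball G (L * r) u. finished j (sweep j \<sigma>) x"
    proof
      fix x assume "x \<in> hop_ball G (L * r) u"
      then have "x \<in> hop_ball G (Q - j * (L * r)) v"
        using Suc.prems by (intro hop_ball_trans[OF Suc.prems(2)]) auto
      then show "finished j (sweep j \<sigma>) x" using Suc by simp
    qed
    show u: "u \<in> set ws" using Suc.prems(2) hop_ball_mono unfolding ws by (meson diff_le_self)
    show "finished (Suc j) (act r L \<rho> pick G u \<tau>) u"
      if "\<forall>x\<in>hop_ball G (L * r) u. finished j \<tau> x" for \<tau>
      using that u ws ball_nodes by (intro finished_Suc_act[OF G]) auto
  qed (auto intro: finished_act)
  then show ?case by simp
qed (simp add: finished_def)

text \<open>All levels are below \<open>L\<close>, so a node that has finished the levels below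
  \<open>L\<close> must have a centre.\<close>

lemma clustered_sweep:
  assumes \<sigma>: "clustering r (L * r) G \<sigma>" and le: "L * (L * r) \<le> Q"
    and u: "u \<in> hop_ball G (Q - L * (L * r)) v"
  shows "ctr (sweep L \<sigma>) u \<noteq> None"
proof -
  have "u \<in> nodes G" using u hop_ball_mono ball_nodes by (meson diff_le_self subsetD)
  then have "lev (sweep L \<sigma>) u < L"
    using G by (intro lev_bound[OF clustering_sweep[OF \<sigma>]]) (auto simp: well_formed_def)
  then show ?thesis using finished_sweep[OF \<sigma> le u] by (simp add: finished_def)
qed

text \<open>The first \<open>L\<close> sweeps settle the clusters around \<open>v\<close>, and with
  them the levels and the dependency set \<open>?D\<close>. After \<open>j\<close> further sweeps
  all nodes of \<open>?D\<close> with fewer than \<open>j\<close> predecessors in \<open>?D\<close>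
  are fixed, and \<open>v\<close> has fewer predecessors than the graph has nodes.\<close>

lemma fixed_sweep:
  assumes \<sigma>: "clustering r (L * r) G \<sigma>" and r: "r \<le> \<rho>"
    and Q: "L * (2 * (L * r) + r) + \<rho> + L * (L * r) \<le> Q" and N: "card (nodes G) \<le> N"
  shows "ctr (sweep (L + N) \<sigma>) v \<noteq> None \<and> frc (sweep (L + N) \<sigma>) v \<noteq> None"
proof -
  let ?T = "L * (2 * (L * r) + r)"
  define \<tau> where "\<tau> = sweep L \<sigma>"
  let ?D = "deps r G (lev \<tau>) v"
  \<comment> \<open>While this holds, \<open>prec\<close> computed from the running state agrees
    with \<open>prec (lev \<tau>)\<close> near \<open>v\<close>, so the rank below keeps its
    meaning.\<close>
  define frozen where "frozen \<tau>' \<longleftrightarrow>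
    (\<forall>u\<in>hop_ball G (?T + \<rho>) v. ctr \<tau>' u \<noteq> None \<and> lev \<tau>' u = lev \<tau> u)" for \<tau>' :: "nat \<Rightarrow> 'v node_state"
  have ctr: "ctr \<tau> u \<noteq> None" if "u \<in> hop_ball G (?T + \<rho>) v" for u
    using hop_ball_mono[OF that] Q unfolding \<tau>_def by (intro clustered_sweep[OF \<sigma>]) auto
  then have frozen: "frozen \<tau>" by (simp add: frozen_def)
  have frozen_act: "frozen (act r L \<rho> pick G w \<tau>')" if "frozen \<tau>'" for \<tau>' w
    using that act_mono(1,2)[of \<tau>' _ r L \<rho> pick G w] unfolding frozen_def by metis
  have near: "?D \<subseteq> hop_ball G ?T v"
    using clustering_sweep[OF \<sigma>] ctr r hop_ball_mono[of _ G "?T + r" v "?T + \<rho>"] v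
    unfolding \<tau>_def by (intro subsetI deps_near[OF G]) auto
  have D: "?D \<subseteq> nodes G" "?D \<subseteq> set ws"
    using near hop_ball_mono[of _ G ?T v Q] Q ball_nodes unfolding ws by (auto 4 4)
  then have finD: "finite ?D" using G finite_subset by (auto simp: well_formed_def)
  define rank where "rank w = card {u \<in> ?D. prec (lev \<tau>) u w}" for w
  have "frozen (sweep j \<tau>) \<and> (\<forall>w\<in>?D. rank w < j \<longrightarrow> frc (sweep j \<tau>) w \<noteq> None)" for j
  proof (induction j)
    case (Suc j)
    let ?I = "\<lambda>\<tau>'. frozen \<tau>' \<and> (\<forall>w\<in>?D. rank w < j \<longrightarrow> frc \<tau>' w \<noteq> None)"
    have I: "?I (act r L \<rho> pick G x \<tau>')" if "?I \<tau>'" for x \<tau>'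
      using that frozen_act act_mono(4)[of \<tau>' _ r L \<rho> pick G x] by metis
    have "frc (fold (act r L \<rho> pick G) ws (sweep j \<tau>)) w \<noteq> None" if w: "w \<in> ?D" "rank w < Suc j" for w
    proof (rule fold_progress[where w = w and I = ?I])
      fix \<tau>' assume \<tau>': "?I \<tau>'"
      have sub: "hop_ball G \<rho> w \<subseteq> hop_ball G (?T + \<rho>) v"
        using hop_ball_trans near w(1) by blast
      have lw: "ctr \<tau>' w \<noteq> None" "lev \<tau>' w = lev \<tau> w"
        using \<tau>' subsetD[OF sub hop_ball_self] unfolding frozen_def by auto
      have "frc \<tau>' u \<noteq> None" if u: "u \<in> hop_ball G r w" "prec (lev \<tau>') u w" for u
      proof -
        have "u \<in> hop_ball G \<rho> w" using u(1) r hop_ball_mono by blast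
        then have "lev \<tau>' u = lev \<tau> u" using \<tau>' sub unfolding frozen_def by auto
        then have p: "prec (lev \<tau>) u w" using u(2) lw by (simp add: prec_def)
        then have uD: "u \<in> ?D" using deps_step[OF w(1) u(1)] by simp
        have "{x \<in> ?D. prec (lev \<tau>) x u} \<subset> {x \<in> ?D. prec (lev \<tau>) x w}"
        proof
          show "{x \<in> ?D. prec (lev \<tau>) x u} \<subseteq> {x \<in> ?D. prec (lev \<tau>) x w}"
            using prec_trans[OF _ p] by blast
          show "{x \<in> ?D. prec (lev \<tau>) x u} \<noteq> {x \<in> ?D. prec (lev \<tau>) x w}"
            using p uD prec_irrefl by blast
        qed
        then have "rank u < rank w" unfolding rank_def using finD by (intro psubset_card_mono) auto
        then show ?thesis using \<tau>' uD w(2) by auto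
      qed
      then have "may_fix r \<rho> G w \<tau>'" if "frc \<tau>' w = None"
        using that \<tau>' sub unfolding may_fix_def frozen_def by blast
      then show "frc (act r L \<rho> pick G w \<tau>') w \<noteq> None"
        using lw act_mono(4)[of \<tau>' w r L \<rho> pick G w] by (cases "frc \<tau>' w") (auto simp: act_def)
    next
      show "frc (act r L \<rho> pick G x \<tau>') w \<noteq> None" if "frc \<tau>' w \<noteq> None" for x \<tau>'
        using that act_mono(4)[of \<tau>' w r L \<rho> pick G x] by simp
    qed (use w D I Suc in auto)
    moreover have "frozen (fold (act r L \<rho> pick G) ws (sweep j \<tau>))"
      using Suc frozen_act by (intro fold_invariant[where P = frozen and Q = "\<lambda>_. True"]) auto
    ultimately show ?case by simp
  qed (simp add: frozen)
  then have main: "frozen (sweep j \<tau>)" "w \<in> ?D \<Longrightarrow> rank w < j \<Longrightarrow> frc (sweep j \<tau>) w \<noteq> None" for j w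
    by blast+
  have "rank v < N"
  proof -
    have fin: "finite (nodes G)" using G by (simp add: well_formed_def)
    have "rank v \<le> card (nodes G - {v})"
      unfolding rank_def
    proof (rule card_mono)
      show "{u \<in> ?D. prec (lev \<tau>) u v} \<subseteq> nodes G - {v}"
      proof
        fix u assume "u \<in> {u \<in> ?D. prec (lev \<tau>) u v}"
        then have "u \<in> ?D" "prec (lev \<tau>) u v" by simp_all
        then have "u \<in> nodes G" "u \<noteq> v" using D(1) by auto
        then show "u \<in> nodes G - {v}" by blast
      qed
    qed (use fin in simp)
    also have "\<dots> < card (nodes G)" using fin v by (rule card_Diff1_less)
    finally show ?thesis using N by (rule less_le_trans)
  qed
  then have "frc (sweep N \<tau>) v \<noteq> None" using main(2)[OF deps_self] by simp
  with main(1)[of N] have "ctr (sweep N \<tau>) v \<noteq> None \<and> frc (sweep N \<tau>) v \<noteq> None"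
    by (simp add: frozen_def)
  moreover have "sweep N \<tau> = sweep (L + N) \<sigma>"
    unfolding \<tau>_def add.commute[of L N] funpow_add by simp
  ultimately show ?thesis by simp
qed

end

section \<open>Random bits and conditional failure probabilities\<close>

lemma slocal_run_cong:
  "(\<And>v. v \<in> set xs \<Longrightarrow> step v = step' v) \<Longrightarrow> slocal_run step r G xs = slocal_run step' r G xs"
  by (induction xs rule: rev_induct) (simp_all add: slocal_run_snoc)

text \<open>The reachable memory states form a countable set, so measurability of a run can be
  checked state by state.\<close>

lemma countable_finite_maps: "countable {m :: nat \<rightharpoonup> 'v::countable. finite (dom m)}"
proof (rule countable_subset)
  show "{m :: nat \<rightharpoonup> 'v. finite (dom m)} \<subseteq> range map_of"
  proof
    fix m :: "nat \<rightharpoonup> 'v" assume "m \<in> {m. finite (dom m)}"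
    then have "m = map_of (map (\<lambda>k. (k, the (m k))) (sorted_list_of_set (dom m)))"
      by (auto simp: map_of_map_restrict[unfolded comp_def] restrict_map_def fun_eq_iff domIff)
    then show "m \<in> range map_of" by blast
  qed
qed simp

text \<open>One probability space for all graphs, so that failure probabilities on a graph and on a
  view of it can be compared for the same sample.\<close>

definition bits :: "(nat \<Rightarrow> nat \<Rightarrow> bool) measure" where
  "bits = PiM UNIV (\<lambda>_. fair_bits)"

lemma prob_space_fair_bits: "prob_space fair_bits"
  unfolding fair_bits_def by (intro prob_space_PiM) (simp add: prob_space_measure_pmf)

lemma prob_space_bits: "prob_space bits"
  unfolding bits_def by (intro prob_space_PiM prob_space_fair_bits)

lemma space_fair_bits [simp]: "space fair_bits = UNIV"
  by (auto simp: fair_bits_def space_PiM)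

lemma space_bits [simp]: "space bits = UNIV"
  by (auto simp: bits_def space_PiM)

lemma node_bits_eq_distr:
  "finite (nodes G) \<Longrightarrow> node_bits G = distr bits (node_bits G) (\<lambda>x. restrict x (nodes G))"
proof -
  assume fin: "finite (nodes G)"
  interpret product_prob_space "\<lambda>_ :: nat. fair_bits" UNIV
    using prob_space_fair_bits by (rule product_prob_spaceI)
  show ?thesis
    using distr_PiM_restrict_finite[OF fin] by (simp add: node_bits_def bits_def)
qed

lemma measurable_restrict_bits: "(\<lambda>x. restrict x J) \<in> bits \<rightarrow>\<^sub>M PiM J (\<lambda>_. fair_bits)"
  unfolding bits_def by (rule measurable_restrict_subset) simp

text \<open>Redrawing the bits of one node preserves the distribution; with Fubini this isolates the
  randomness of that node.\<close>

lemma bits_resample: "distr (fair_bits \<Otimes>\<^sub>M bits) bits (\<lambda>(b, x). x(v := b)) = bits"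
  using distr_pair_PiM_eq_PiM[of UNIV "\<lambda>_. fair_bits" v] prob_space_fair_bits
  by (simp add: bits_def)

text \<open>Forcing a stored value takes the place of conditioning on the random bits of a
  node.\<close>

definition forced :: "(nat \<rightharpoonup> 'v) \<Rightarrow> (nat \<Rightarrow> 'w \<Rightarrow> 'v) \<Rightarrow> nat \<Rightarrow> 'w \<Rightarrow> 'v" where
  "forced f step v W = (case f v of Some s \<Rightarrow> s | None \<Rightarrow> step v W)"

text \<open>Induction on the order: for each of the countably many states before a step, the step
  reads a fixed view and is measurable by \<open>A\<close>.\<close>

lemma measurable_slocal_run:
  fixes A :: "nat \<Rightarrow> (nat \<Rightarrow> bool) \<Rightarrow> ('i \<times> ('o::countable \<times> bool list) option) lgraph \<Rightarrow> 'o \<times> bool list"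
  assumes A: "\<And>v W. (\<lambda>x. A v x W) \<in> fair_bits \<rightarrow>\<^sub>M count_space UNIV"
    and proj: "\<And>v. v \<in> set xs \<Longrightarrow> (\<lambda>x. x v) \<in> M \<rightarrow>\<^sub>M fair_bits"
  shows "(\<lambda>x. slocal_run (forced f (\<lambda>v. A v (x v))) r G xs) \<in> M \<rightarrow>\<^sub>M count_space {m. finite (dom m)}"
  using proj
proof (induction xs rule: rev_induct)
  case (snoc v xs)
  let ?run = "\<lambda>x. slocal_run (forced f (\<lambda>v. A v (x v))) r G"
  have IH: "(\<lambda>x. ?run x xs) \<in> M \<rightarrow>\<^sub>M count_space {m. finite (dom m)}"
    using snoc by simp
  have step: "(\<lambda>x. S(v \<mapsto> forced f (\<lambda>v. A v (x v)) v (view (annotate G S) r v)))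
      \<in> M \<rightarrow>\<^sub>M count_space {m. finite (dom m)}" if S: "S \<in> {m. finite (dom m)}" for S
  proof -
    have "(\<lambda>x. A v (x v) (view (annotate G S) r v)) \<in> M \<rightarrow>\<^sub>M count_space UNIV"
      using measurable_compose[OF snoc.prems A] by simp
    then have "(\<lambda>x. forced f (\<lambda>v. A v (x v)) v (view (annotate G S) r v)) \<in> M \<rightarrow>\<^sub>M count_space UNIV"
      by (cases "f v") (simp_all add: forced_def)
    moreover have "(\<lambda>y. S(v \<mapsto> y)) \<in> count_space UNIV \<rightarrow>\<^sub>M count_space {m. finite (dom m)}"
      using S by simp
    ultimately show ?thesis by (rule measurable_compose)
  qed
  show ?case
    unfolding slocal_run_snoc
    by (rule measurable_compose_countable'[OF step IH countable_finite_maps])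
qed simp

lemma sets_slocal_run:
  fixes A :: "nat \<Rightarrow> (nat \<Rightarrow> bool) \<Rightarrow> ('i \<times> ('o::countable \<times> bool list) option) lgraph \<Rightarrow> 'o \<times> bool list"
  assumes "\<And>v W. (\<lambda>x. A v x W) \<in> fair_bits \<rightarrow>\<^sub>M count_space UNIV"
    and "\<And>v. v \<in> set xs \<Longrightarrow> (\<lambda>x. x v) \<in> M \<rightarrow>\<^sub>M fair_bits"
  shows "{x \<in> space M. Q (slocal_run (forced f (\<lambda>v. A v (x v))) r G xs)} \<in> sets M"
proof -
  let ?run = "\<lambda>x. slocal_run (forced f (\<lambda>v. A v (x v))) r G xs"
  have m: "?run \<in> M \<rightarrow>\<^sub>M count_space {m. finite (dom m)}"
    by (rule measurable_slocal_run) fact+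
  have "{x \<in> space M. Q (?run x)} = ?run -` {m. finite (dom m) \<and> Q m} \<inter> space M"
    by auto
  moreover have "?run -` {m. finite (dom m) \<and> Q m} \<inter> space M \<in> sets M"
    by (rule measurable_sets[OF m]) auto
  ultimately show ?thesis by (simp only:)
qed

section \<open>Failure probabilities for a fixed number of nodes\<close>

locale local_trial =
  fixes A :: "nat \<Rightarrow> (nat \<Rightarrow> bool) \<Rightarrow> ('i \<times> ('o::countable \<times> bool list) option) lgraph \<Rightarrow> 'o \<times> bool list"
    and r d :: nat and acc :: "nat \<Rightarrow> ('i \<times> 'o option) lgraph \<Rightarrow> bool"
  assumes meas: "(\<lambda>x. A v x W) \<in> fair_bits \<rightarrow>\<^sub>M count_space UNIV"
begin

definition run where
  "run G lv f x = slocal_run (forced f (\<lambda>v. A v (x v))) r G (level_order lv (nodes G))"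

definition rejects where
  "rejects G S u \<longleftrightarrow> \<not> acc u (view (annotate G (map_option fst \<circ> S)) d u)"

text \<open>The conditional failure probability of the method of conditional expectations; its sum
  over all nodes is the potential to be kept below 1.\<close>

definition failure :: "'i lgraph \<Rightarrow> (nat \<Rightarrow> nat) \<Rightarrow> (nat \<rightharpoonup> 'o \<times> bool list) \<Rightarrow> nat \<Rightarrow> real" where
  "failure G lv f u = measure bits {x. rejects G (run G lv f x) u}"

lemma run_fixpoint:
  "finite (nodes G) \<Longrightarrow>
   slocal_fixpoint (forced f (\<lambda>v. A v (x v))) r G lv (nodes G) (run G lv f x)"
  unfolding run_def using slocal_fixpoint_run[OF distinct_level_order sorted_wrt_level_order]
  by (metis set_level_order)

lemma dom_run [simp]: "finite (nodes G) \<Longrightarrow> dom (run G lv f x) = nodes G"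
  by (simp add: run_def)

lemma run_forced: "finite (nodes G) \<Longrightarrow> v \<in> nodes G \<Longrightarrow> f v = Some y \<Longrightarrow> run G lv f x v = Some y"
  using run_fixpoint[of G f x lv] by (simp add: slocal_fixpoint_def forced_def)

lemma sets_rejects: "{x. rejects G (run G lv f x) u} \<in> sets bits"
proof -
  have "(\<lambda>x. x v) \<in> bits \<rightarrow>\<^sub>M fair_bits" for v
    unfolding bits_def by (rule measurable_component_singleton) simp
  then show ?thesis
    using sets_slocal_run[of A "level_order lv (nodes G)" bits "\<lambda>S. rejects G S u" f r G] meas
    by (simp add: run_def)
qed

text \<open>For each sample the two runs agree on \<open>X\<close> by
  \<open>slocal_fixpoint_local\<close>, and the verifier at \<open>u\<close> reads only values in
  \<open>X\<close>. The two rejection events are thus equal.\<close>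

lemma failure_cong:
  assumes fin: "finite (nodes G)" "finite (nodes G')" and X: "X \<subseteq> nodes G" "X \<subseteq> nodes G'"
    and u: "hop_ball G d u \<subseteq> X" "view G d u = view G' d u"
    and f: "\<And>v. v \<in> X \<Longrightarrow> f v = f' v"
    and view: "\<And>v. v \<in> X \<Longrightarrow> view G r v = view G' r v"
    and prec: "\<And>v w. v \<in> X \<Longrightarrow> w \<in> hop_ball G r v \<Longrightarrow> prec lv w v \<longleftrightarrow> prec lv' w v"
    and closed: "\<And>v w. v \<in> X \<Longrightarrow> w \<in> hop_ball G r v \<Longrightarrow> prec lv w v \<Longrightarrow> w \<in> X"
  shows "failure G lv f u = failure G' lv' f' u"
proof -
  have "run G lv f x v = run G' lv' f' x v" if "v \<in> X" for v x
    by (rule slocal_fixpoint_local[OF run_fixpoint[OF fin(1)] run_fixpoint[OF fin(2)] X _ view prec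
          closed that]) (auto simp: forced_def f)
  then have "annotate (view G d u) (map_option fst \<circ> run G lv f x) =
      annotate (view G d u) (map_option fst \<circ> run G' lv' f' x)" for x
    using u(1) by (intro annotate_view_cong) auto
  then have "rejects G (run G lv f x) u = rejects G' (run G' lv' f' x) u" for x
    by (simp add: rejects_def view_annotate u(2))
  then show ?thesis by (simp add: failure_def)
qed

text \<open>If everything the algorithm reads at \<open>w\<close> is already forced, the bits of \<open>w\<close> only influence
  the run through the value stored at \<open>w\<close>.\<close>

lemma run_reveal:
  assumes G: "finite (nodes G)" "edges G \<subseteq> nodes G \<times> nodes G" and w: "w \<in> nodes G" "f w = None"
    and f: "\<And>u. u \<in> hop_ball G r w \<Longrightarrow> prec lv u w \<Longrightarrow> f u \<noteq> None"
  obtains W where "\<And>x b. run G lv f (x(w := b)) = run G lv (f(w \<mapsto> A w b W)) x"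
proof
  \<comment> \<open>All that \<open>w\<close> reads are forced values of its predecessors, so this
    view depends neither on \<open>x\<close> nor on \<open>b\<close>.\<close>
  define W where "W = annotate (view G r w) (f |` {u. prec lv u w})"
  fix x b
  let ?x = "x(w := b)" and ?y = "A w b W"
  let ?S = "run G lv f ?x"
  have fix_S: "slocal_fixpoint (forced f (\<lambda>v. A v (?x v))) r G lv (nodes G) ?S"
    by (rule run_fixpoint) fact
  have "annotate (view G r w) (?S |` {u. prec lv u w}) = W"
    unfolding W_def
  proof (rule annotate_view_cong)
    fix u assume u: "u \<in> hop_ball G r w"
    then have "u \<in> nodes G" using hop_ball_subset[OF G(2) w(1)] by blast
    then show "(?S |` {u. prec lv u w}) u = (f |` {u. prec lv u w}) u"
      using f[OF u] run_forced[OF G(1)] by (cases "f u") (auto simp: restrict_map_def)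
  qed
  moreover have S: "dom ?S = nodes G" "\<And>v. v \<in> nodes G \<Longrightarrow>
      ?S v = Some (forced f (\<lambda>v. A v (?x v)) v (annotate (view G r v) (?S |` {u. prec lv u v})))"
    using fix_S unfolding slocal_fixpoint_def by blast+
  ultimately have Sw: "?S w = Some ?y" using w by (simp add: forced_def)
  have "?S v = Some (forced (f(w \<mapsto> ?y)) (\<lambda>v. A v (x v)) v (annotate (view G r v) (?S |` {u. prec lv u v})))"
    if "v \<in> nodes G" for v
  proof (cases "v = w")
    case True
    then show ?thesis using Sw by (simp add: forced_def)
  next
    case False
    then show ?thesis using S(2)[OF that] by (simp add: forced_def)
  qed
  \<comment> \<open>The run with bits \<open>b\<close> at \<open>w\<close> also solves the equations
    of the run in which the resulting value is forced, and their solution is unique.\<close>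
  then have "slocal_fixpoint (forced (f(w \<mapsto> ?y)) (\<lambda>v. A v (x v))) r G lv (nodes G) ?S"
    unfolding slocal_fixpoint_def using S(1) by blast
  then show "?S = run G lv (f(w \<mapsto> ?y)) x"
    by (rule slocal_fixpoint_unique) (rule run_fixpoint, fact)
qed

text \<open>The present sum is the average, over the bits of \<open>w\<close>, of the sums with the
  resulting value forced at \<open>w\<close>. They cannot all exceed their average.\<close>

lemma exists_good_value:
  assumes G: "finite (nodes G)" "edges G \<subseteq> nodes G \<times> nodes G" and w: "w \<in> nodes G" "f w = None"
    and f: "\<And>u. u \<in> hop_ball G r w \<Longrightarrow> prec lv u w \<Longrightarrow> f u \<noteq> None" and U: "finite U"
  shows "\<exists>y. (\<Sum>u\<in>U. failure G lv (f(w \<mapsto> y)) u) \<le> (\<Sum>u\<in>U. failure G lv f u)"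
proof (rule ccontr)
  assume "\<not> ?thesis"
  then have less: "(\<Sum>u\<in>U. failure G lv f u) < (\<Sum>u\<in>U. failure G lv (f(w \<mapsto> y)) u)" for y
    unfolding not_ex not_le by blast
  obtain W where W: "\<And>x b. run G lv f (x(w := b)) = run G lv (f(w \<mapsto> A w b W)) x"
    by (rule run_reveal[of G w f lv]) (use G w f in auto)
  interpret F: prob_space fair_bits by (rule prob_space_fair_bits)
  interpret B: prob_space bits by (rule prob_space_bits)
  interpret P: pair_prob_space fair_bits bits ..
  \<comment> \<open>The number of rejecting nodes in \<open>U\<close>; by linearity its expectation
    is the sum of the failure probabilities.\<close>
  define c where "c f x = (\<Sum>u\<in>U. indicat_real {x. rejects G (run G lv f x) u} x)" for f x
  have int: "integrable bits (c f)" "(\<integral>x. c f x \<partial>bits) = (\<Sum>u\<in>U. failure G lv f u)" for f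
    using sets_rejects[of G lv f] unfolding c_def failure_def
    by (simp_all add: B.emeasure_eq_measure)
  have upd: "(\<lambda>(b, x). x(w := b)) \<in> fair_bits \<Otimes>\<^sub>M bits \<rightarrow>\<^sub>M bits"
    unfolding bits_def case_prod_unfold by (rule measurable_fun_upd[where J = UNIV]) simp_all
  have "integrable (distr (fair_bits \<Otimes>\<^sub>M bits) bits (\<lambda>(b, x). x(w := b))) (c f)"
    using int(1) by (simp add: bits_resample)
  then have int2: "integrable (fair_bits \<Otimes>\<^sub>M bits) (\<lambda>(b, x). c f (x(w := b)))"
    using integrable_distr[OF upd] by (simp add: case_prod_unfold)
  \<comment> \<open>Redraw the bits of \<open>w\<close>, then integrate over the bits of the other
    nodes first.\<close>
  have "(\<integral>x. c f x \<partial>bits) = (\<integral>(b, x). c f (x(w := b)) \<partial>(fair_bits \<Otimes>\<^sub>M bits))"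
    using integral_distr[OF upd borel_measurable_integrable[OF int(1)], of f]
    unfolding bits_resample by (simp add: case_prod_unfold)
  also have "\<dots> = (\<integral>b. (\<integral>x. c f (x(w := b)) \<partial>bits) \<partial>fair_bits)"
    using P.integral_fst'[OF int2] by simp
  also have "(\<lambda>b. \<integral>x. c f (x(w := b)) \<partial>bits) = (\<lambda>b. \<Sum>u\<in>U. failure G lv (f(w \<mapsto> A w b W)) u)"
  proof
    fix b
    have "c f (x(w := b)) = c (f(w \<mapsto> A w b W)) x" for x
      by (simp add: c_def W indicator_def)
    then show "(\<integral>x. c f (x(w := b)) \<partial>bits) = (\<Sum>u\<in>U. failure G lv (f(w \<mapsto> A w b W)) u)"
      by (simp add: int(2))
  qed
  also have "(\<integral>b. (\<Sum>u\<in>U. failure G lv (f(w \<mapsto> A w b W)) u) \<partial>fair_bits) > (\<Sum>u\<in>U. failure G lv f u)"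
  proof (rule F.expectation_greater)
    have "(\<lambda>b. \<Sum>u\<in>U. failure G lv (f(w \<mapsto> A w b W)) u) = (\<lambda>b. \<integral>x. c f (x(w := b)) \<partial>bits)"
    proof
      fix b
      have "c f (x(w := b)) = c (f(w \<mapsto> A w b W)) x" for x
        by (simp add: c_def W indicator_def)
      then show "(\<Sum>u\<in>U. failure G lv (f(w \<mapsto> A w b W)) u) = (\<integral>x. c f (x(w := b)) \<partial>bits)"
        by (simp add: int(2))
    qed
    then show "integrable fair_bits (\<lambda>b. \<Sum>u\<in>U. failure G lv (f(w \<mapsto> A w b W)) u)"
      using P.integrable_fst'[OF int2] by simp
  qed (simp add: less)
  finally show False by (simp add: int(2))
qed

end

section \<open>The derandomized algorithm\<close>

abbreviation frcs :: "(nat \<Rightarrow> 'v node_state) \<Rightarrow> nat \<rightharpoonup> 'v" where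
  "frcs \<sigma> \<equiv> (\<lambda>u. frc \<sigma> u)"

context local_trial
begin

text \<open>Only nodes within \<open>T\<close> of \<open>w\<close> are affected by the value at
  \<open>w\<close> (\<open>failure_far\<close>), so this local sum decides about the global
  one.\<close>

definition pick ::
  "nat \<Rightarrow> 'i lgraph \<Rightarrow> nat \<Rightarrow> (nat \<Rightarrow> ('o \<times> bool list) node_state) \<Rightarrow> 'o \<times> bool list" where
  "pick T G w \<sigma> = (SOME y. (\<Sum>u\<in>hop_ball G T w. failure G (lev \<sigma>) ((frcs \<sigma>)(w \<mapsto> y)) u)
     \<le> (\<Sum>u\<in>hop_ball G T w. failure G (lev \<sigma>) (frcs \<sigma>) u))"

text \<open>The verdict of a node depends on values within \<open>d\<close>, and these on values at
  most \<open>T0\<close> further, hence \<open>T\<close>. Evaluating the verdicts of all nodes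
  within \<open>T\<close> of \<open>w\<close> involves nodes within \<open>2 * T\<close> and their
  views of radius \<open>r\<close>, hence \<open>\<rho>\<close>.\<close>

context
  fixes G :: "'i lgraph" and lv :: "nat \<Rightarrow> nat" and T0 T \<rho> w :: nat
  assumes G: "well_formed G" and w: "w \<in> nodes G"
    and near: "\<And>v. v \<in> nodes G \<Longrightarrow> deps r G lv v \<subseteq> hop_ball G T0 v"
    and T: "T = d + T0" and \<rho>: "\<rho> = 2 * T + r"
begin

private lemma graph:
  "finite (nodes G)" "edges G \<subseteq> nodes G \<times> nodes G" "sym (edges G)"
  "\<And>v k. v \<in> nodes G \<Longrightarrow> hop_ball G k v \<subseteq> nodes G"
  using G hop_ball_subset[of G] by (simp_all add: well_formed_def)

text \<open>Everything that can influence the verdict of \<open>u\<close>; it serves as the closed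
  set \<open>X\<close> in \<open>failure_cong\<close>.\<close>

private definition scope :: "nat \<Rightarrow> nat set" where
  "scope u = (\<Union>v\<in>hop_ball G d u. deps r G lv v)"

private lemma scope_ball:
  assumes "u \<in> nodes G" shows "scope u \<subseteq> hop_ball G T u"
proof
  fix x assume "x \<in> scope u"
  then obtain v where v: "v \<in> hop_ball G d u" "x \<in> deps r G lv v" by (auto simp: scope_def)
  then have "x \<in> hop_ball G T0 v" using near graph(4)[OF assms] by blast
  then show "x \<in> hop_ball G T u" by (rule hop_ball_trans[OF v(1)]) (simp add: T)
qed

private lemma scope_self: "hop_ball G d u \<subseteq> scope u"
proof
  show "v \<in> scope u" if "v \<in> hop_ball G d u" for v
    unfolding scope_def using deps_self that by (rule UN_I[rotated])
qed

private lemma scope_closed: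
  assumes "v \<in> scope u" "x \<in> hop_ball G r v" "prec lv x v" shows "x \<in> scope u"
proof -
  obtain z where "z \<in> hop_ball G d u" "v \<in> deps r G lv z" using assms(1) by (auto simp: scope_def)
  then show ?thesis using deps_step[OF _ assms(2,3)] by (auto simp: scope_def)
qed

text \<open>The scope of \<open>u\<close> lies within \<open>2 * T\<close> of \<open>w\<close>, so
  the view of radius \<open>\<rho>\<close> contains it together with all views of radius
  \<open>r\<close> read there.\<close>

lemma failure_view:
  assumes u: "u \<in> hop_ball G T w" and lv': "\<And>v. v \<in> hop_ball G \<rho> w \<Longrightarrow> lv' v = lv v"
    and f': "\<And>v. v \<in> hop_ball G \<rho> w \<Longrightarrow> f' v = f v"
  shows "failure (view G \<rho> w) lv' f' u = failure G lv f u"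
proof (rule failure_cong[symmetric, where X = "scope u"])
  have un: "u \<in> nodes G" using u graph(4)[OF w] by blast
  have sub: "scope u \<subseteq> hop_ball G (2 * T) w"
    using scope_ball[OF un] hop_ball_trans[OF u, of _ T "2 * T"] by auto
  have sub_\<rho>: "scope u \<subseteq> hop_ball G \<rho> w"
    using sub hop_ball_mono[of _ G "2 * T" w \<rho>] \<rho> by auto
  show "finite (nodes G)" "finite (nodes (view G \<rho> w))"
    using graph(1) finite_hop_ball[OF G w] by simp_all
  show "scope u \<subseteq> nodes G" using scope_ball[OF un] graph(4)[OF un] by blast
  show "scope u \<subseteq> nodes (view G \<rho> w)" using sub_\<rho> by simp
  show "hop_ball G d u \<subseteq> scope u" by (rule scope_self)
  show "view G d u = view (view G \<rho> w) d u"
    using view_view[OF u, of d \<rho>] T \<rho> by simp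
  show "f v = f' v" if "v \<in> scope u" for v using f' that sub_\<rho> by auto
  show "view G r v = view (view G \<rho> w) r v" if "v \<in> scope u" for v
    using view_view[of v G "2 * T" w r \<rho>] that sub \<rho> by auto
  show "prec lv x v \<longleftrightarrow> prec lv' x v" if "v \<in> scope u" "x \<in> hop_ball G r v" for x v
  proof -
    have "x \<in> hop_ball G \<rho> w"
      using that sub \<rho> by (intro hop_ball_trans[of v G "2 * T" w x r]) auto
    then show ?thesis using lv' that sub_\<rho> by (auto simp: prec_def)
  qed
  show "x \<in> scope u" if "v \<in> scope u" "x \<in> hop_ball G r v" "prec lv x v" for v x
    by (rule scope_closed[OF that])
qed

text \<open>The scope of \<open>u\<close> stays within \<open>T\<close> of \<open>u\<close> and
  therefore misses \<open>w\<close>.\<close>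

lemma failure_far:
  assumes u: "u \<in> nodes G" "u \<notin> hop_ball G T w"
  shows "failure G lv (f(w \<mapsto> y)) u = failure G lv f u"
proof (rule failure_cong[where X = "scope u"])
  have "w \<notin> scope u" using scope_ball[OF u(1)] u(2) hop_ball_sym[OF graph(3)] by blast
  then show "(f(w \<mapsto> y)) v = f v" if "v \<in> scope u" for v using that by auto
  show "scope u \<subseteq> nodes G" using scope_ball[OF u(1)] graph(4)[OF u(1)] by blast
  then show "scope u \<subseteq> nodes G" .
  show "x \<in> scope u" if "v \<in> scope u" "x \<in> hop_ball G r v" "prec lv x v" for v x
    by (rule scope_closed[OF that])
qed (use graph scope_self in auto)

text \<open>Here \<open>lv\<close> stands for the final levels, while \<open>\<sigma>\<close> is an
  intermediate state. The two agree at clustered nodes, and \<open>may_fix\<close> guarantees that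
  everything within \<open>\<rho>\<close> is clustered.\<close>

lemma pick_improves:
  assumes may: "may_fix r \<rho> G w \<sigma>"
    and lv: "\<And>u. u \<in> nodes G \<Longrightarrow> ctr \<sigma> u \<noteq> None \<Longrightarrow> lev \<sigma> u = lv u"
  defines "y \<equiv> pick T (view G \<rho> w) w (masked (hop_ball G \<rho> w) \<sigma>)"
  shows "(\<Sum>u\<in>nodes G. failure G lv ((frcs \<sigma>)(w \<mapsto> y)) u) \<le> (\<Sum>u\<in>nodes G. failure G lv (frcs \<sigma>) u)"
proof -
  let ?H = "view G \<rho> w" and ?\<tau> = "masked (hop_ball G \<rho> w) \<sigma>" and ?U = "hop_ball G T w"
  have levels: "lev \<sigma> v = lv v" if "v \<in> hop_ball G \<rho> w" for v
    using may lv that graph(4)[OF w] unfolding may_fix_def by blast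
  have "r \<le> \<rho>" "T \<le> \<rho>" by (simp_all add: \<rho>)
  have ball: "hop_ball ?H T w = ?U"
    using \<open>T \<le> \<rho>\<close> by (intro hop_ball_view[where a = 0]) auto
  have eq: "failure ?H (lev ?\<tau>) f' u = failure G lv f u"
    if "u \<in> ?U" "\<And>v. v \<in> hop_ball G \<rho> w \<Longrightarrow> f' v = f v" for f f' u
    using levels by (intro failure_view that) (auto simp: masked_def)
  have eq1: "(\<Sum>u\<in>?U. failure ?H (lev ?\<tau>) (frcs ?\<tau>) u) = (\<Sum>u\<in>?U. failure G lv (frcs \<sigma>) u)"
    by (intro sum.cong refl eq) (auto simp: masked_def)
  have eq2: "(\<Sum>u\<in>?U. failure ?H (lev ?\<tau>) ((frcs ?\<tau>)(w \<mapsto> z)) u) =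
      (\<Sum>u\<in>?U. failure G lv ((frcs \<sigma>)(w \<mapsto> z)) u)" for z
    by (intro sum.cong refl eq) (auto simp: masked_def)
  have "\<exists>z. (\<Sum>u\<in>?U. failure G lv ((frcs \<sigma>)(w \<mapsto> z)) u) \<le> (\<Sum>u\<in>?U. failure G lv (frcs \<sigma>) u)"
  proof (rule exists_good_value)
    show "frc \<sigma> w = None" using may by (simp add: may_fix_def)
    show "frc \<sigma> u \<noteq> None" if u: "u \<in> hop_ball G r w" "prec lv u w" for u
    proof -
      have "lev \<sigma> u = lv u" "lev \<sigma> w = lv w"
        using levels hop_ball_mono[OF u(1) \<open>r \<le> \<rho>\<close>] by auto
      then have "prec (lev \<sigma>) u w" using u(2) by (simp add: prec_def)
      then show ?thesis using may u(1) unfolding may_fix_def by blast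
    qed
  qed (use graph w finite_hop_ball[OF G w] in auto)
  then have good: "(\<Sum>u\<in>?U. failure G lv ((frcs \<sigma>)(w \<mapsto> y)) u) \<le> (\<Sum>u\<in>?U. failure G lv (frcs \<sigma>) u)"
    unfolding y_def pick_def ball eq1 eq2 by (rule someI_ex)
  have split: "(\<Sum>u\<in>nodes G. h u) = (\<Sum>u\<in>?U. h u) + (\<Sum>u\<in>nodes G - ?U. h u)" for h :: "nat \<Rightarrow> real"
    using sum.subset_diff[OF graph(4)[OF w] graph(1)] by (simp add: add.commute)
  have "(\<Sum>u\<in>nodes G - ?U. failure G lv ((frcs \<sigma>)(w \<mapsto> y)) u) = (\<Sum>u\<in>nodes G - ?U. failure G lv (frcs \<sigma>) u)"
    by (intro sum.cong refl failure_far) auto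
  then show ?thesis using good unfolding split by simp
qed

end

section \<open>Assembling the deterministic algorithm\<close>

definition schedule :: "nat \<Rightarrow> nat set \<Rightarrow> nat list" where
  "schedule N B = concat (replicate N (sorted_list_of_set B))"

text \<open>A processed node does the work of its whole ball. In \<open>derandomized_run\<close> the
  number \<open>N\<close> allows \<open>L\<close> sweeps for clustering and one more per node of the
  graph for fixing.\<close>

definition process :: "nat \<Rightarrow> nat \<Rightarrow> nat \<Rightarrow> nat \<Rightarrow> nat \<Rightarrow> 'i lgraph \<Rightarrow> nat
    \<Rightarrow> (nat \<Rightarrow> ('o \<times> bool list) node_state) \<Rightarrow> nat \<Rightarrow> ('o \<times> bool list) node_state" where
  "process N L T \<rho> Q G v =
     fold (localize \<rho> (act r L \<rho> (pick T)) G) (schedule N (hop_ball G Q v))"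

lemma set_schedule: "set (schedule N B) \<subseteq> B"
  by (cases "finite B") (auto simp: schedule_def)

lemma local_update_process: "local_update (Q + \<rho>) (process N L T \<rho> Q)"
proof -
  have "process N L T \<rho> Q = (\<lambda>G v. fold (localize \<rho> (act r L \<rho> (pick T)) G) (schedule N (hop_ball G Q v)))"
    by (simp add: process_def fun_eq_iff)
  then show ?thesis
    by (simp only:) (rule local_update_fold[where xs = "schedule N", OF local_update_localize set_schedule])
qed

text \<open>In the end every value is forced, so each failure probability is 0 or 1, and a potential
  below 1 excludes rejection. The hypothesis \<open>unlikely\<close> ranges over all
  \<open>lv\<close>, since the levels arise only during the run.\<close>

lemma derandomized_run:
  fixes N L T \<rho> Q T0 :: nat and G :: "'i lgraph"
  assumes G: "well_formed G" "card (nodes G) < 2 ^ L" and ord: "processing_order G ord"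
    and T0: "T0 = L * (2 * (L * r) + r)" and T: "T = d + T0" and \<rho>: "\<rho> = 2 * T + r"
    and Q: "Q = T0 + \<rho> + L * (L * r)" and N: "N = L + card (nodes G)"
    and unlikely: "\<And>lv. (\<Sum>u\<in>nodes G. failure G lv Map.empty u) < 1"
  defines "out \<equiv> slocal_output (remote_step (Q + \<rho>) (process N L T \<rho> Q) (0, None, None)
      (\<lambda>s. fst (the (snd (snd s))))) (2 * (Q + \<rho>)) G ord"
  shows "dom out = nodes G" and "\<forall>u\<in>nodes G. acc u (view (annotate G out) d u)"
proof -
  have graph: "finite (nodes G)" "edges G \<subseteq> nodes G \<times> nodes G"
    "\<And>v k. v \<in> nodes G \<Longrightarrow> hop_ball G k v \<subseteq> nodes G"
    using G hop_ball_subset[of G] by (simp_all add: well_formed_def)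
  have ord: "distinct ord" "set ord = nodes G" using ord by (simp_all add: processing_order_def)
  define pick' where "pick' G w \<sigma> = pick T (view G \<rho> w) w (masked (hop_ball G \<rho> w) \<sigma>)"
    for G :: "'i lgraph" and w \<sigma>
  define step where "step = act r L \<rho> pick' G"
  define init :: "nat \<Rightarrow> ('o \<times> bool list) node_state" where "init = (\<lambda>_. (0, None, None))"
  \<comment> \<open>Flattening turns the whole computation into one sequence of single actions,
    along which invariants are followed.\<close>
  define work where "work vs = concat (map (\<lambda>v. schedule N (hop_ball G Q v)) vs)" for vs
  have step: "localize \<rho> (act r L \<rho> (pick T)) G = step"
  proof -
    have "r \<le> \<rho>" by (simp add: \<rho>)
    moreover have "L * r \<le> \<rho>" by (cases L) (simp_all add: \<rho> T T0)
    ultimately show ?thesis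
      by (intro ext) (simp add: localize_act step_def pick'_def[abs_def])
  qed
  have process: "fold (process N L T \<rho> Q G) vs \<sigma> = fold step (work vs) \<sigma>" for vs \<sigma>
    by (induction vs arbitrary: \<sigma>) (simp_all add: work_def process_def step)
  have work_nodes: "set (work vs) \<subseteq> nodes G" if "set vs \<subseteq> nodes G" for vs
    using that set_schedule graph(3) unfolding work_def by fastforce
  define \<sigma> where "\<sigma> = fold step (work ord) init"
  define lv where "lv = lev \<sigma>"
  have clust: "clustering r (L * r) G (fold step ws init)" if "set ws \<subseteq> nodes G" for ws
    unfolding step_def init_def by (rule clustering_fold_act[OF G(1) that clustering_init])
  \<comment> \<open>The value of \<open>v\<close> is fixed when \<open>v\<close> has been processed
    and is permanent, so the committed output agrees with the final state.\<close>
  have settled: "ctr \<sigma> v \<noteq> None \<and> frc \<sigma> v \<noteq> None \<and>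
      frc \<sigma> v = frc (fold step (work (xs @ [v])) init) v" if split: "ord = xs @ v # ys" for xs v ys
  proof -
    have v: "v \<in> nodes G" "set xs \<subseteq> nodes G" using ord(2) split by auto
    let ?\<tau> = "fold step (work xs) init"
    have "fold step (work [v]) ?\<tau> = (fold step (sorted_list_of_set (hop_ball G Q v)) ^^ N) ?\<tau>"
      by (simp add: work_def schedule_def fold_concat_replicate)
    then have now: "ctr (fold step (work [v]) ?\<tau>) v \<noteq> None \<and> frc (fold step (work [v]) ?\<tau>) v \<noteq> None"
      using fixed_sweep[OF G v(1) _ clust[OF work_nodes[OF v(2)]], of "sorted_list_of_set (hop_ball G Q v)"
          Q \<rho> "card (nodes G)" pick'] finite_hop_ball[OF G(1) v(1)]
      unfolding step_def N by (simp add: \<rho> T Q T0)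
    have "fold step (work (xs @ [v])) init = fold step (work [v]) ?\<tau>"
      by (simp add: work_def)
    moreover have "\<sigma> = fold step (work ys) (fold step (work [v]) ?\<tau>)"
      by (simp add: \<sigma>_def split work_def)
    ultimately show ?thesis using now unfolding step_def by (simp add: fold_act_mono)
  qed
  have all: "ctr \<sigma> v \<noteq> None" "frc \<sigma> v \<noteq> None" if v: "v \<in> nodes G" for v
  proof -
    obtain xs ys where "ord = xs @ v # ys" using v ord(2) by (metis split_list)
    then show "ctr \<sigma> v \<noteq> None" "frc \<sigma> v \<noteq> None" using settled by blast+
  qed
  have near: "deps r G lv v \<subseteq> hop_ball G T0 v" if "v \<in> nodes G" for v
    unfolding lv_def T0 \<sigma>_def
    using deps_near[OF G clust[OF work_nodes] that] all graph(3)[OF that] ord(2)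
    unfolding \<sigma>_def by blast
  \<comment> \<open>The potential is followed through all prefixes of the work and measured with the
    final levels \<open>lv\<close> throughout, so that carving leaves it unchanged.\<close>
  have potential: "(\<Sum>u\<in>nodes G. failure G lv (frcs (fold step xs init)) u) < 1"
    if "work ord = xs @ ys" for xs ys
    using that
  proof (induction xs arbitrary: ys rule: rev_induct)
    case Nil
    then show ?case using unlikely by (simp add: init_def)
  next
    case (snoc w xs)
    let ?\<tau> = "fold step xs init"
    have \<sigma>: "\<sigma> = fold step (w # ys) ?\<tau>" by (simp add: \<sigma>_def snoc.prems)
    have w: "w \<in> nodes G" using work_nodes[of ord] ord(2) snoc.prems by auto
    have IH: "(\<Sum>u\<in>nodes G. failure G lv (frcs ?\<tau>) u) < 1" using snoc by simp
    show ?case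
    proof (cases "ctr ?\<tau> w \<noteq> None \<and> may_fix r \<rho> G w ?\<tau>")
      case True
      have "lev ?\<tau> u = lv u" if "ctr ?\<tau> u \<noteq> None" for u
        unfolding lv_def \<sigma> step_def using that by (simp add: fold_act_mono(2) step_def del: fold.simps)
      then have "(\<Sum>u\<in>nodes G. failure G lv ((frcs ?\<tau>)(w \<mapsto> pick' G w ?\<tau>)) u) \<le>
          (\<Sum>u\<in>nodes G. failure G lv (frcs ?\<tau>) u)"
        unfolding pick'_def using True by (intro pick_improves[OF G(1) w near T \<rho>]) auto
      moreover have "frcs (step w ?\<tau>) = (frcs ?\<tau>)(w \<mapsto> pick' G w ?\<tau>)"
        using True by (auto simp: step_def act_def)
      ultimately show ?thesis using IH by simp
    next
      case False
      then have "frcs (step w ?\<tau>) = frcs ?\<tau>"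
        by (auto simp: step_def act_def carve_def Let_def)
      then show ?thesis using IH by simp
    qed
  qed
  define S where "S = frcs \<sigma> |` nodes G"
  \<comment> \<open>With a value forced at every node the run ignores the random bits.\<close>
  have run: "run G lv (frcs \<sigma>) x = S" for x
  proof
    fix v show "run G lv (frcs \<sigma>) x v = S v"
    proof (cases "v \<in> nodes G")
      case True
      then show ?thesis using all(2)[OF True] run_forced[OF graph(1) True] by (auto simp: S_def)
    next
      case False
      then have "v \<notin> dom (run G lv (frcs \<sigma>) x)" using dom_run[OF graph(1)] by simp
      then have "run G lv (frcs \<sigma>) x v = None" by (simp only: domIff simp_thms)
      then show ?thesis using False by (simp add: S_def)
    qed
  qed
  have out: "out = map_option fst \<circ> S"
  proof
    fix v show "out v = (map_option fst \<circ> S) v"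
    proof (cases "v \<in> nodes G")
      case True
      then obtain xs ys where split: "ord = xs @ v # ys" using ord(2) by (metis split_list)
      then have "distinct (xs @ v # ys)" "set (xs @ v # ys) \<subseteq> nodes G" using ord by simp_all
      then have "out v = Some (fst (the (frc (fold step (work (xs @ [v])) init) v)))"
        unfolding out_def init_def split process[symmetric]
        by (rule slocal_output_remote_step[OF local_update_process G(1)])
      then have "out v = Some (fst (the (frc \<sigma> v)))" using settled[OF split] by simp
      then show ?thesis using all(2)[OF True] True by (auto simp: S_def)
    next
      case False
      then have "v \<notin> dom (slocal_run st R G ord)" for st R using ord(2) by simp
      then have "slocal_run st R G ord v = None" for st R by (simp only: domIff simp_thms)
      then show ?thesis using False by (simp add: out_def slocal_output_def S_def)
    qed
  qed
  show "dom out = nodes G"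
  proof (rule set_eqI)
    show "v \<in> dom out \<longleftrightarrow> v \<in> nodes G" for v
      using all(2)[of v] by (cases "v \<in> nodes G") (auto simp: out S_def)
  qed
  show "\<forall>u\<in>nodes G. acc u (view (annotate G out) d u)"
  proof (rule ccontr)
    assume "\<not> ?thesis"
    then obtain u where u: "u \<in> nodes G" "rejects G S u" unfolding rejects_def out by blast
    \<comment> \<open>The run is constant, so a rejecting node rejects with certainty and alone
      lifts the potential to 1.\<close>
    then have "failure G lv (frcs \<sigma>) u = 1"
      using prob_space.prob_space[OF prob_space_bits] by (simp add: failure_def run)
    moreover have "failure G lv (frcs \<sigma>) u \<le> (\<Sum>u\<in>nodes G. failure G lv (frcs \<sigma>) u)"
      using u graph(1) by (intro member_le_sum) (auto simp: failure_def)
    ultimately show False using potential[of "work ord" "[]"] unfolding \<sigma>_def by simp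
  qed
qed

end

text \<open>A valid output is accepted at \<open>u\<close>, so validity and rejection at
  \<open>u\<close> are disjoint events. The bound moves from \<open>node_bits G\<close> to
  \<open>bits\<close> because the run reads only the bits of nodes of \<open>G\<close>.\<close>

lemma (in local_trial) failure_less:
  fixes G :: "'i lgraph"
  assumes G: "well_formed G" and valid: "\<And>out. dom out = nodes G \<Longrightarrow>
      valid P G out \<longleftrightarrow> (\<forall>v\<in>nodes G. acc v (view (annotate G out) d v))"
    and likely: "measure (node_bits G) {x \<in> space (node_bits G).
        valid P G (slocal_output (\<lambda>v. A v (x v)) r G (level_order lv (nodes G)))} > 1 - \<epsilon>"
    and u: "u \<in> nodes G"
  shows "failure G lv Map.empty u < \<epsilon>"
proof -
  let ?ord = "level_order lv (nodes G)"
  let ?S = "\<lambda>x. run G lv Map.empty x"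
  have fin: "finite (nodes G)" using G by (simp add: well_formed_def)
  have run: "slocal_run (\<lambda>v. A v (x v)) r G ?ord = ?S x" for x
    unfolding run_def by (rule slocal_run_cong) (simp add: forced_def fun_eq_iff)
  have restrict: "?S (restrict x (nodes G)) = ?S x" for x
    unfolding run_def by (rule slocal_run_cong) (use fin in \<open>simp add: forced_def fun_eq_iff\<close>)
  define Q where "Q S \<longleftrightarrow> valid P G (map_option fst \<circ> S)" for S :: "nat \<rightharpoonup> 'o \<times> bool list"
  have sets: "{x \<in> space M. Q (?S x)} \<in> sets M"
    if "\<And>v. v \<in> nodes G \<Longrightarrow> (\<lambda>x. x v) \<in> M \<rightarrow>\<^sub>M fair_bits" for M
    unfolding run_def using that fin by (intro sets_slocal_run meas) simp
  have set_node: "{x \<in> space (node_bits G). Q (?S x)} \<in> sets (node_bits G)"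
    by (rule sets) (simp add: node_bits_def measurable_component_singleton)
  have set_bits: "{x. Q (?S x)} \<in> sets bits"
  proof -
    have "(\<lambda>x. x v) \<in> bits \<rightarrow>\<^sub>M fair_bits" for v
      unfolding bits_def by (rule measurable_component_singleton) simp
    from sets[OF this] show ?thesis by simp
  qed
  interpret B: prob_space bits by (rule prob_space_bits)
  have rn: "(\<lambda>x. restrict x (nodes G)) \<in> bits \<rightarrow>\<^sub>M node_bits G"
    unfolding node_bits_def by (rule measurable_restrict_bits)
  have "1 - \<epsilon> < measure (node_bits G) {x \<in> space (node_bits G). Q (?S x)}"
    using likely by (simp add: Q_def slocal_output_def run)
  also have "\<dots> = measure (distr bits (node_bits G) (\<lambda>x. restrict x (nodes G)))
      {x \<in> space (node_bits G). Q (?S x)}"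
    by (simp flip: node_bits_eq_distr[OF fin])
  also have "\<dots> = measure bits ((\<lambda>x. restrict x (nodes G)) -` {x \<in> space (node_bits G). Q (?S x)} \<inter> space bits)"
    by (rule measure_distr[OF rn set_node])
  also have "(\<lambda>x. restrict x (nodes G)) -` {x \<in> space (node_bits G). Q (?S x)} \<inter> space bits = {x. Q (?S x)}"
    using measurable_space[OF rn] by (auto simp: restrict)
  finally have "1 - \<epsilon> < measure bits {x. Q (?S x)}" .
  moreover have "{x. Q (?S x)} \<inter> {x. rejects G (?S x) u} = {}"
  proof -
    have "dom (map_option fst \<circ> ?S x) = nodes G" for x
      using dom_run[OF fin, of lv Map.empty x] by auto
    then show ?thesis using valid u by (auto simp: Q_def rejects_def)
  qed
  then have "measure bits {x. Q (?S x)} + failure G lv Map.empty u =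
      measure bits ({x. Q (?S x)} \<union> {x. rejects G (?S x) u})"
    unfolding failure_def using set_bits sets_rejects by (intro B.finite_measure_Union[symmetric])
  moreover have "measure bits ({x. Q (?S x)} \<union> {x. rejects G (?S x) u}) \<le> 1" by (rule B.prob_le_1)
  ultimately show ?thesis by linarith
qed

section \<open>The logarithmic bound and the final locality\<close>

definition bit_length :: "nat \<Rightarrow> nat" where
  "bit_length n = (LEAST l. n < 2 ^ l)"

lemma less_bit_length: "n < 2 ^ bit_length n"
  unfolding bit_length_def by (rule LeastI[where k = n]) (rule less_exp)

text \<open>For \<open>bit_length n = Suc l\<close>, minimality gives \<open>2 ^ l \<le> n\<close>,
  so \<open>l\<close> is at most twice the logarithm as \<open>ln 2\<close> exceeds 1/2. The
  remaining 1 is at most \<open>ln n\<close> because \<open>n\<close> is at least e.\<close>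

lemma bit_length_le:
  assumes "3 \<le> n" shows "real (bit_length n) \<le> 3 * ln (real n)"
proof (cases "bit_length n")
  case (Suc l)
  then have "\<not> n < 2 ^ l" using not_less_Least[of l "\<lambda>l. n < 2 ^ l"] by (simp add: bit_length_def)
  then have "2 ^ l \<le> real n" by (metis not_less numeral_power_le_of_nat_cancel_iff)
  then have "ln (2 ^ l) \<le> ln (real n)" using assms by (subst ln_le_cancel_iff) auto
  then have "real l * ln 2 \<le> ln (real n)" by (simp add: ln_realpow)
  moreover have "1 / 2 * real l \<le> ln 2 * real l"
    using ln2_ge_two_thirds by (intro mult_right_mono) auto
  moreover have "exp 1 \<le> real n" using exp_le assms by linarith
  then have "1 \<le> ln (real n)" using assms by (subst ln_ge_iff) auto
  ultimately show ?thesis using Suc by (simp add: mult.commute)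
qed (use assms in simp)

theorem theorem1p11:
  fixes b r :: "nat \<Rightarrow> nat"
    and P :: "('i::countable, 'o::countable) problem"
    and A :: "('i, 'o) rand_slocal_alg"
  assumes id_length: "(\<lambda>n. real (b n)) \<in> O(\<lambda>n. ln (real n))"
    and locality_pos: "\<And>n. 1 \<le> r n"
    and checkable: "locally_checkable b P"
    and randomized: "monte_carlo_slocal_solves b P A r"
  shows "\<exists>(B :: ('i, 'o) slocal_alg) (R :: nat \<Rightarrow> nat).
           (\<lambda>n. real (R n)) \<in> O(\<lambda>n. real (r n) * (ln (real n))\<^sup>2) \<and>
           slocal_solves b P B R"
proof -
  obtain d acc where acc: "\<And>G out. G \<in> instances P \<Longrightarrow> network b G \<Longrightarrow> dom out = nodes G \<Longrightarrow>
      valid P G out \<longleftrightarrow> (\<forall>v\<in>nodes G. acc (size_of G) v (view (annotate G out) d v))"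
    using checkable unfolding locally_checkable_def by blast
  have meas: "(\<lambda>x. A n v x W) \<in> fair_bits \<rightarrow>\<^sub>M count_space UNIV" for n v W
    using randomized unfolding monte_carlo_slocal_solves_def by blast
  define L where "L = bit_length"
  define T0 where "T0 n = L n * (2 * (L n * r n) + r n)" for n
  define T where "T n = d + T0 n" for n
  define \<rho> where "\<rho> n = 2 * T n + r n" for n
  define Q where "Q n = T0 n + \<rho> n + L n * (L n * r n)" for n
  \<comment> \<open>A simulated update of radius \<open>Q n + \<rho> n\<close> reads snapshots at
    twice that distance.\<close>
  define R where "R n = 2 * (Q n + \<rho> n)" for n
  define B where "B n = remote_step (Q n + \<rho> n)
      (local_trial.process (A n) (r n) d (acc n) (L n + n) (L n) (T n) (\<rho> n) (Q n)) (0, None, None)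
      (\<lambda>s. fst (the (snd (snd s))))" for n
  have "slocal_solves b P B R"
    unfolding slocal_solves_def
  proof (intro ballI impI allI)
    fix G ord assume G: "G \<in> instances P" "network b G" and ord: "processing_order G ord"
    let ?n = "size_of G"
    interpret local_trial "A ?n" "r ?n" d "acc ?n" by unfold_locales (rule meas)
    have wf: "well_formed G" using G(2) by (rule network_well_formed)
    have nodes: "finite (nodes G)" "nodes G \<noteq> {}" using G(2) by (simp_all add: network_def)
    \<comment> \<open>The randomized guarantee covers every fixed order, in particular the one given
      by arbitrary levels \<open>lv\<close>. Strict bounds \<open>1 / ?n\<close> over
      \<open>?n\<close> nodes add up to less than 1.\<close>
    have "failure G lv Map.empty u < 1 / real ?n" if "u \<in> nodes G" for lv u
    proof (rule failure_less[OF wf acc[OF G] _ that])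
      show "1 - 1 / real ?n < measure (node_bits G) {x \<in> space (node_bits G).
          valid P G (slocal_output (\<lambda>v. A ?n v (x v)) (r ?n) G (level_order lv (nodes G)))}"
        using randomized G processing_order_level_order[OF nodes(1)]
        unfolding monte_carlo_slocal_solves_def by blast
    qed
    then have "(\<Sum>u\<in>nodes G. failure G lv Map.empty u) < 1" for lv
      using sum_bounded_above_strict[of "nodes G" "failure G lv Map.empty" "1 / real ?n"] nodes
      by (simp add: card_gt_0_iff)
    note run = derandomized_run[OF wf _ ord T0_def T_def \<rho>_def Q_def refl this]
    have "?n < 2 ^ L ?n" unfolding L_def by (rule less_bit_length)
    from run[OF this] show "valid P G (slocal_output (B ?n) (R ?n) G ord)"
      by (subst acc[OF G]) (simp_all add: B_def R_def)
  qed
  moreover have "(\<lambda>n. real (R n)) \<in> O(\<lambda>n. real (r n) * (ln (real n))\<^sup>2)"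
  proof (rule bigoI)
    show "\<forall>\<^sub>F n in sequentially. norm (real (R n)) \<le>
        (9 * (8 * real d + 36)) * norm (real (r n) * (ln (real n))\<^sup>2)"
      using eventually_ge_at_top[of 3]
    proof eventually_elim
      case (elim n)
      have "L n \<noteq> 0" using less_bit_length[of n] elim by (cases "L n") (auto simp: L_def)
      then have L1: "1 \<le> L n" by simp
      \<comment> \<open>All terms of \<open>R n\<close> are bounded by multiples of
        \<open>m\<close>; absorbing the constant \<open>d\<close> uses \<open>m \<ge> 1\<close>,
        which rests on \<open>1 \<le> r n\<close>.\<close>
      define m where "m = (L n)\<^sup>2 * r n"
      have m: "d \<le> d * m" "L n * r n \<le> m" "r n \<le> m"
        using L1 locality_pos[of n] by (auto simp: m_def power2_eq_square)
      have T0: "T0 n \<le> 3 * m" using m(2) by (simp add: T0_def m_def power2_eq_square algebra_simps)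
      have eq: "L n * (L n * r n) = m" by (simp add: m_def power2_eq_square)
      have "R n = 2 * (5 * T0 n + 4 * d + 2 * r n + m)"
        unfolding R_def Q_def \<rho>_def T_def eq by simp
      also have "\<dots> \<le> 2 * (5 * (3 * m) + 4 * (d * m) + 2 * m + m)"
        by (intro mult_left_mono add_mono T0 m) simp_all
      also have "\<dots> = (8 * d + 36) * m" by (simp add: algebra_simps)
      finally have "R n \<le> (8 * d + 36) * m" .
      then have "real (R n) \<le> real ((8 * d + 36) * m)" by (rule of_nat_mono)
      also have "\<dots> = (8 * real d + 36) * real m" by simp
      also have "\<dots> \<le> (8 * real d + 36) * ((3 * ln (real n))\<^sup>2 * real (r n))"
      proof (rule mult_left_mono)
        show "real m \<le> (3 * ln (real n))\<^sup>2 * real (r n)"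
          unfolding m_def of_nat_mult of_nat_power
          using bit_length_le[OF elim] by (intro mult_right_mono power_mono) (auto simp: L_def)
      qed simp
      also have "\<dots> = (9 * (8 * real d + 36)) * (real (r n) * (ln (real n))\<^sup>2)"
        by (simp add: power_mult_distrib)
      finally show ?case by simp
    qed
  qed
  ultimately show ?thesis by blast
qed

end
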